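(* Let $1\le m\le n-1$ and let $E=E_m$, $M$, $F$, $s$, $\sigma_1,\dots,\sigma_s$, $\mathcal{R}(M)\subset\mathcal{R}(F)=R[w_1,\dots,w_s]$ and $\operatorname{Scr}(\underline{\sigma})$ be as in the context. Then $$\mathcal{R}(M)=R[\{x_0^{\sigma_i-j}x_1^jw_i\mid1\le i\le s,\ 0\le j\le\sigma_i\}]\subset R[w_1,\dots,w_s]=\mathcal{R}(F)$$ and $\mathcal{R}(M)\cong\operatorname{Scr}(\underline{\sigma})$.
   Context: Let $\Bbbk$ be a field, $R=\Bbbk[x_0,x_1]$ with the standard grading, $\mathfrak{m}=(x_0,x_1)$. For a finitely generated $R$-module $E$, the Rees algebra $\mathcal{R}(E)$ is the symmetric algebra of $E$ modulo its $R$-torsion. Let $I\subset R$ be a height two ideal minimally generated by $n$ forms of degree $d$, with graded free (Hilbert-Burch) resolution $0\to\bigoplus_{i=1}^{n-1}R(-d_i)\xrightarrow{\varphi}R^n\to I(d)\to0$, $1\le d_1\le\cdots\le d_{n-1}$. For $1\le m\le n-1$ let $\varphi_m$ be the matrix of the first $m$ columns of $\varphi$ and $E_m=\operatorname{coker}\varphi_m$. Fix $m$; set $s=n-m$, $E=E_m$ (torsionfree of rank $s$, generated in degree 0), $F=E^{**}$ where $-^*=\operatorname{Hom}_R(-,R)$. $F$ is graded free; fix $F\cong\bigoplus_{i=1}^sR(\sigma_i)$ with $\sigma_1\ge\cdots\ge\sigma_s\ge0$. Let $M=F_{\ge0}=\bigoplus_{i=1}^s\mathfrak{m}^{\sigma_i}(\sigma_i)$.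 $\mathcal{R}(F)=R[w_1,\dots,w_s]$ is a polynomial ring with $w_i$ corresponding to the $i$th basis element of $F$, and $M\subset F$ induces $\mathcal{R}(M)\subset\mathcal{R}(F)$. For nonnegative integers $\sigma_1,\dots,\sigma_s$, let $V=R[\{v_{i,j}\mid1\le i\le s,\ 0\le j\le\sigma_i\}]$ be a polynomial ring and $$\Gamma=\left[\begin{array}{c|cccc|c|cccc} x_0&v_{1,0}&v_{1,1}&\cdots&v_{1,\sigma_1-1}&\cdots&v_{s,0}&v_{s,1}&\cdots&v_{s,\sigma_s-1} \\ x_1&v_{1,1}&v_{1,2}&\cdots&v_{1,\sigma_1}&\cdots&v_{s,1}&v_{s,2}&\cdots&v_{s,\sigma_s}\end{array}\right]$$ (the $i$th block is empty if $\sigma_i=0$). Define $\operatorname{Scr}(\underline{\sigma})=V/I_2(\Gamma)$, where $I_2(\Gamma)$ is the ideal of $2\times2$ minors. The isomorphism is one of $R$-algebras. *)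

theory Defs
  imports
    "HOL-Library.Poly_Mapping"
    "HOL-Library.Numeral_Type"
    "HOL-Library.Extended_Nat"
    "HOL-Algebra.Algebra"
    "HOL-Algebra.Algebraic_Closure_Type"
    "Jordan_Normal_Form.Matrix"
    "Jordan_Normal_Form.Determinant"
    "Jordan_Normal_Form.DL_Submatrix"
begin

section \<open>Polynomial algebras\<close>

type_synonym ('v, 'a) mpol = "('v \<Rightarrow>\<^sub>0 nat) \<Rightarrow>\<^sub>0 'a"

definition Var :: "'v \<Rightarrow> ('v, 'a::zero_neq_one) mpol" where
  "Var v = Poly_Mapping.single (Poly_Mapping.single v 1) 1"

definition Const :: "'a::zero \<Rightarrow> ('v, 'a) mpol" where
  "Const c = Poly_Mapping.single 0 c"

definition indets :: "('v, 'a::zero) mpol \<Rightarrow> 'v set" where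
  "indets p = (\<Union>t\<in>Poly_Mapping.keys p. Poly_Mapping.keys t)"

text \<open>The polynomial ring over \<^typ>\<open>'a\<close> in the variables \<open>I\<close>, as an \<^typ>\<open>'a\<close>-algebra.\<close>

definition mpol_alg :: "'v set \<Rightarrow> ('a::comm_ring_1, ('v, 'a) mpol) module" where
  "mpol_alg I = \<lparr>carrier = {p. indets p \<subseteq> I}, monoid.mult = (*), one = 1, ring.zero = 0, add = (+),
     module.smult = (\<lambda>r p. Const r * p)\<rparr>"

text \<open>\<open>R = k[x\<^sub>0, x\<^sub>1]\<close>, with its standard grading extended by \<open>0\<close> to negative degrees.\<close>

type_synonym 'k polyR = "(2, 'k) mpol"

definition x0 :: "'k::field polyR" where "x0 = Var 0"
definition x1 :: "'k::field polyR" where "x1 = Var 1"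

definition forms :: "int \<Rightarrow> 'k::field polyR set" where
  "forms j = {p. \<forall>t\<in>Poly_Mapping.keys p.
     int (\<Sum>v\<in>Poly_Mapping.keys t. Poly_Mapping.lookup t v) = j}"


section \<open>Height of an ideal\<close>

definition prime_height :: "('a, 'b) ring_scheme \<Rightarrow> 'a set \<Rightarrow> enat" where
  "prime_height A Q = Sup {enat l | l. \<exists>P :: nat \<Rightarrow> 'a set.
     (\<forall>i\<le>l. primeideal (P i) A) \<and> (\<forall>i<l. P i \<subset> P (Suc i)) \<and> P l = Q}"

definition ideal_height :: "('a, 'b) ring_scheme \<Rightarrow> 'a set \<Rightarrow> enat" where
  "ideal_height A I = Inf (prime_height A ` {Q. primeideal Q A \<and> I \<subseteq> Q})"


section \<open>Modules and algebras\<close>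

text \<open>Modules over a type \<^typ>\<open>'r\<close> of class \<^class>\<open>comm_ring_1\<close> are records of type
  \<^typ>\<open>('r, 'm) module\<close>; when such a record is used only as a module its fields
  \<^const>\<open>monoid.mult\<close> and \<^const>\<open>one\<close> are irrelevant. Consequently the following
  definition gives both the quotient of a module by a submodule and the quotient of an algebra
  by an ideal.\<close>

definition quot_module :: "('r, 'm) module \<Rightarrow> 'm set \<Rightarrow> ('r, 'm set) module" where
  "quot_module M N = \<lparr>carrier = a_rcosets\<^bsub>M\<^esub> N, monoid.mult = rcoset_mult M N, one = N +>\<^bsub>M\<^esub> \<one>\<^bsub>M\<^esub>,
     ring.zero = N, add = set_add M, module.smult = (\<lambda>r S. \<Union>x\<in>S. N +>\<^bsub>M\<^esub> (r \<odot>\<^bsub>M\<^esub> x))\<rparr>"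

definition alg_hom :: "('r, 'a) module \<Rightarrow> ('r, 'b) module \<Rightarrow> ('a \<Rightarrow> 'b) set" where
  "alg_hom A B = {h \<in> Ring.ring_hom A B. \<forall>r. \<forall>a\<in>carrier A. h (r \<odot>\<^bsub>A\<^esub> a) = r \<odot>\<^bsub>B\<^esub> h a}"

definition alg_iso :: "('r, 'a) module \<Rightarrow> ('r, 'b) module \<Rightarrow> ('a \<Rightarrow> 'b) set" where
  "alg_iso A B = {h \<in> alg_hom A B. bij_betw h (carrier A) (carrier B)}"

definition subalg_gen :: "'v set \<Rightarrow> ('v, 'r::comm_ring_1) mpol set \<Rightarrow> ('v, 'r) mpol set" where
  "subalg_gen I S = generate_ring (mpol_alg I) (range Const \<union> S)"

definition dual :: "('r::comm_ring_1, 'm) module \<Rightarrow> ('r, 'm \<Rightarrow> 'r) module" where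
  "dual M = \<lparr>carrier = {h \<in> extensional (carrier M).
       (\<forall>x\<in>carrier M. \<forall>y\<in>carrier M. h (x \<oplus>\<^bsub>M\<^esub> y) = h x + h y) \<and>
       (\<forall>r. \<forall>x\<in>carrier M. h (r \<odot>\<^bsub>M\<^esub> x) = r * h x)},
     monoid.mult = undefined, one = undefined,
     ring.zero = (\<lambda>x\<in>carrier M. 0), add = (\<lambda>g h. \<lambda>x\<in>carrier M. g x + h x),
     module.smult = (\<lambda>r h. \<lambda>x\<in>carrier M. r * h x)\<rparr>"

definition coker :: "'r::comm_ring_1 mat \<Rightarrow> ('r, 'r vec set) module" where
  "coker A = quot_module (module_vec TYPE('r) (dim_row A))
     ((\<lambda>v. A *\<^sub>v v) ` carrier_vec (dim_col A))"

definition first_cols :: "nat \<Rightarrow> 'r mat \<Rightarrow> 'r mat" where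
  "first_cols m A = mat_of_cols (dim_row A) (take m (cols A))"


section \<open>Gradings\<close>

text \<open>A grading of an \<open>R\<close>-module is given by its homogeneous components, a function from
  \<^typ>\<open>int\<close> to sets of elements.\<close>

text \<open>The components of \<open>R(a\<^sub>0) \<oplus> \<dots> \<oplus> R(a\<^sub>n\<^sub>-\<^sub>1)\<close>, where \<open>R(a)\<^sub>j = R\<^sub>a\<^sub>+\<^sub>j\<close>.\<close>

definition free_grading :: "nat \<Rightarrow> (nat \<Rightarrow> int) \<Rightarrow> int \<Rightarrow> 'k::field polyR vec set" where
  "free_grading n a j = {v \<in> carrier_vec n. \<forall>i<n. v $ i \<in> forms (a i + j)}"

text \<open>The grading of a cokernel induced by \<open>R\<^sup>n\<close> with basis in degree \<open>0\<close>.\<close>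

definition coker_grading :: "'k::field polyR mat \<Rightarrow> int \<Rightarrow> 'k polyR vec set set" where
  "coker_grading A j = (\<lambda>v. ((\<lambda>u. A *\<^sub>v u) ` carrier_vec (dim_col A))
     +>\<^bsub>module_vec TYPE('k polyR) (dim_row A)\<^esub> v) ` free_grading (dim_row A) (\<lambda>_. 0) j"

definition dual_grading ::
  "('k::field polyR, 'm) module \<Rightarrow> (int \<Rightarrow> 'm set) \<Rightarrow> int \<Rightarrow> ('m \<Rightarrow> 'k polyR) set" where
  "dual_grading M gr j = {h \<in> carrier (dual M). \<forall>i. \<forall>x\<in>gr i. h x \<in> forms (i + j)}"

definition graded_iso ::
  "('r, 'm) module \<Rightarrow> (int \<Rightarrow> 'm set) \<Rightarrow> ('r, 'n) module \<Rightarrow> (int \<Rightarrow> 'n set) \<Rightarrow> ('m \<Rightarrow> 'n) set" where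
  "graded_iso M grM N grN = {h \<in> iso (add_monoid M) (add_monoid N).
     (\<forall>r. \<forall>x\<in>carrier M. h (r \<odot>\<^bsub>M\<^esub> x) = r \<odot>\<^bsub>N\<^esub> h x) \<and> (\<forall>j. h ` grM j = grN j)}"

text \<open>The truncation \<open>M\<^sub>\<ge>\<^sub>0\<close>, i.e. the sum of the components of nonnegative degree.\<close>

definition trunc_nonneg :: "('r, 'm) module \<Rightarrow> (int \<Rightarrow> 'm set) \<Rightarrow> ('r, 'm) module" where
  "trunc_nonneg M gr = M\<lparr>carrier := generate (add_monoid M) (\<Union>j\<in>{0..}. gr j)\<rparr>"


section \<open>Symmetric algebra and Rees algebra\<close>

text \<open>\<open>Sym(E)\<close> is presented with one variable for each element of \<open>E\<close>, modulo the linear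
  relations holding in \<open>E\<close>.\<close>

definition sym_rel :: "('r::comm_ring_1, 'm) module \<Rightarrow> ('m, 'r) mpol set" where
  "sym_rel E = Idl\<^bsub>mpol_alg (carrier E) :: ('r, ('m, 'r) mpol) module\<^esub>
     ({Var (x \<oplus>\<^bsub>E\<^esub> y) - (Var x + Var y) | x y. x \<in> carrier E \<and> y \<in> carrier E} \<union>
      {Var (r \<odot>\<^bsub>E\<^esub> x) - Const r * Var x | r x. x \<in> carrier E})"

definition sym_alg :: "('r::comm_ring_1, 'm) module \<Rightarrow> ('r, ('m, 'r) mpol set) module" where
  "sym_alg E = quot_module (mpol_alg (carrier E)) (sym_rel E)"

definition torsion :: "('r::idom, 'm) module \<Rightarrow> 'm set" where
  "torsion M = {x \<in> carrier M. \<exists>r. r \<noteq> 0 \<and> r \<odot>\<^bsub>M\<^esub> x = \<zero>\<^bsub>M\<^esub>}"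

definition rees :: "('r::idom, 'm) module \<Rightarrow> ('r, ('m, 'r) mpol set set) module" where
  "rees E = quot_module (sym_alg E) (torsion (sym_alg E))"

text \<open>The degree one element of the Rees algebra given by an element of \<open>E\<close>.\<close>

definition rees_in :: "('r::idom, 'm) module \<Rightarrow> 'm \<Rightarrow> ('m, 'r) mpol set set" where
  "rees_in E x =
     torsion (sym_alg E) +>\<^bsub>sym_alg E\<^esub> (sym_rel E +>\<^bsub>mpol_alg (carrier E) :: ('r, ('m, 'r) mpol) module\<^esub> Var x)"


section \<open>Rational normal scrolls\<close>

definition minors :: "nat \<Rightarrow> 'a::comm_ring_1 mat \<Rightarrow> 'a set" where
  "minors t A = {det (submatrix A I J) | I J.
     I \<subseteq> {..<dim_row A} \<and> card I = t \<and> J \<subseteq> {..<dim_col A} \<and> card J = t}"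

text \<open>The variables \<open>v\<^sub>i\<^sub>,\<^sub>j\<close> are indexed by pairs \<open>(i, j)\<close> with \<open>i < s\<close> (counted from \<open>0\<close>)
  and \<open>j \<le> \<sigma> i\<close>.\<close>

definition scroll_matrix :: "nat \<Rightarrow> (nat \<Rightarrow> nat) \<Rightarrow> (nat \<times> nat, 'k::field polyR) mpol mat" where
  "scroll_matrix s \<sigma> = mat_of_cols 2
     (vec_of_list [Const x0, Const x1] #
      [vec_of_list [Var (i, j), Var (i, Suc j)]. i \<leftarrow> [0..<s], j \<leftarrow> [0..<\<sigma> i]])"

definition Scr :: "nat \<Rightarrow> (nat \<Rightarrow> nat) \<Rightarrow> ('k::field polyR, (nat \<times> nat, 'k polyR) mpol set) module" where
  "Scr s \<sigma> = (let V = mpol_alg {(i, j). i < s \<and> j \<le> \<sigma> i}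
     in quot_module V (Idl\<^bsub>V\<^esub> (minors 2 (scroll_matrix s \<sigma>))))"

end

theory Submission
  imports Defs
begin

text \<open>
  The map \<open>\<Psi>\<close> identifies \<open>F\<close> with \<open>R\<^sup>s\<close>, and the truncation \<open>M\<close> with the submodule \<open>U\<close> of the
  vectors whose \<open>i\<close>th entry lies in the \<open>\<sigma>\<^sub>i\<close>th power of the maximal ideal \<open>(x\<^sub>0, x\<^sub>1)\<close>
  (\<open>trunc_carrier\<close>).

  Let \<open>U\<close> be any submodule of \<open>R\<^sup>s\<close> that contains a nonzero multiple \<open>c\<^sub>i e\<^sub>i\<close> of every basis
  vector, and consider the homomorphism from \<open>Sym(U)\<close> to \<open>R[w\<^sub>1, \<dots>, w\<^sub>s]\<close> that sends \<open>v\<close> to the linear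
  form with coefficients \<open>v\<close>. Its kernel is exactly the torsion of \<open>Sym(U)\<close>. It contains the torsion
  because \<open>R[w\<^sub>1, \<dots>, w\<^sub>s]\<close> is a domain. Conversely, the product of the \<open>c\<^sub>i\<close> multiplies every \<open>v\<close> into
  the span of the \<open>c\<^sub>i e\<^sub>i\<close>, so that a nonzero multiple of any element of \<open>Sym(U)\<close> is a polynomial in the
  \<open>c\<^sub>i e\<^sub>i\<close> (\<open>common_denominator\<close>); and their images \<open>c\<^sub>i w\<^sub>i\<close> are algebraically independent. Hence the
  Rees algebra of \<open>U\<close> is the subalgebra of \<open>R[w\<^sub>1, \<dots>, w\<^sub>s]\<close> generated by the linear forms with
  coefficients in \<open>U\<close> (\<open>rees_embedding\<close>). For \<open>U = R\<^sup>s\<close> this is the whole polynomial ring, and for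
  the truncation it is generated by the \<open>x\<^sub>0^(\<sigma>\<^sub>i-j) x\<^sub>1^j w\<^sub>i\<close>, because the monomials of degree
  \<open>\<sigma>\<^sub>i\<close> generate the \<open>\<sigma>\<^sub>i\<close>th power of the maximal ideal (\<open>subalg_gen_linear_forms\<close>).

  It remains to see that the surjection from \<open>V\<close> onto this subalgebra, sending \<open>v\<^sub>i\<^sub>,\<^sub>j\<close> to
  \<open>x\<^sub>0^(\<sigma>\<^sub>i-j) x\<^sub>1^j w\<^sub>i\<close>, has kernel \<open>I\<^sub>2(\<Gamma>)\<close> (\<open>scroll_ideal_eq_kernel\<close>). The minors are in the
  kernel because in the image the second row of \<open>\<Gamma>\<close> is \<open>x\<^sub>1/x\<^sub>0\<close> times the first. For the converse,
  monomials go to monomials, so it suffices that two monomials with the same image are congruent modulo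
  the minors. Treat \<open>x\<^sub>0, x\<^sub>1\<close> as the variables of one more block, of width one. The
  image of a monomial determines how many variables of each block it has, and the sum of their second
  indices. A minor of \<open>\<Gamma>\<close> says precisely that the second index of one variable may be raised by one while
  that of another is lowered by one, and such moves connect any two monomials with the same data
  (\<open>word_val_cong\<close>).
\<close>

section \<open>Substitution homomorphisms between polynomial algebras\<close>

definition monomial_value :: "('v \<Rightarrow> 'b::comm_ring_1) \<Rightarrow> ('v \<Rightarrow>\<^sub>0 nat) \<Rightarrow> 'b" where
  "monomial_value \<phi> t = (\<Prod>v\<in>Poly_Mapping.keys t. \<phi> v ^ Poly_Mapping.lookup t v)"

text \<open>The homomorphism of \<open>R\<close>-algebras that is determined by the images of the variables.\<close>

definition subst :: "('v \<Rightarrow> ('w, 'r) mpol) \<Rightarrow> ('v, 'r::comm_ring_1) mpol \<Rightarrow> ('w, 'r) mpol" where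
  "subst \<phi> p =
     (\<Sum>t\<in>Poly_Mapping.keys p. Const (Poly_Mapping.lookup p t) * monomial_value \<phi> t)"

lemma Const_simps [simp]:
  "Const 0 = 0" "Const 1 = 1" "Const (a + b) = Const a + Const b"
  "Const (a * b) = Const a * Const b"
  by (simp_all add: Const_def single_add mult_single)

lemma Const_eq_0_iff [simp]: "Const c = 0 \<longleftrightarrow> c = 0"
  by (metis Const_def lookup_single_eq lookup_zero single_zero)

lemma Const_power [simp]: "Const (a ^ n) = Const (a::'r::comm_ring_1) ^ n"
  by (induction n) simp_all

lemma Const_prod [simp]: "Const (prod f A) = (\<Prod>x\<in>A. Const (f x :: 'r::comm_ring_1))"
  by (induction A rule: infinite_finite_induct) simp_all

lemma monomial_value_superset:
  assumes "finite K" "Poly_Mapping.keys t \<subseteq> K"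
  shows "monomial_value \<phi> t = (\<Prod>v\<in>K. \<phi> v ^ Poly_Mapping.lookup t v)"
  unfolding monomial_value_def
  by (rule prod.mono_neutral_left) (use assms in \<open>auto simp: in_keys_iff\<close>)

lemma monomial_value_0 [simp]: "monomial_value \<phi> 0 = 1"
  by (simp add: monomial_value_def)

lemma monomial_value_single [simp]: "monomial_value \<phi> (Poly_Mapping.single v n) = \<phi> v ^ n"
  by (cases "n = 0") (simp_all add: monomial_value_def)

lemma monomial_value_add:
  "monomial_value \<phi> (s + t) = monomial_value \<phi> s * monomial_value \<phi> t"
proof -
  let ?K = "Poly_Mapping.keys s \<union> Poly_Mapping.keys t"
  have "monomial_value \<phi> (s + t) = (\<Prod>v\<in>?K. \<phi> v ^ Poly_Mapping.lookup (s + t) v)"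
    by (rule monomial_value_superset) (simp_all add: keys_add)
  also have "\<dots> = (\<Prod>v\<in>?K. \<phi> v ^ Poly_Mapping.lookup s v) *
      (\<Prod>v\<in>?K. \<phi> v ^ Poly_Mapping.lookup t v)"
    by (simp add: lookup_add power_add prod.distrib)
  also have "\<dots> = monomial_value \<phi> s * monomial_value \<phi> t"
    by (subst (1 2) monomial_value_superset[of ?K]) auto
  finally show ?thesis .
qed

lemma poly_mapping_sum_singles:
  "p = (\<Sum>t\<in>Poly_Mapping.keys p. Poly_Mapping.single t (Poly_Mapping.lookup p t))"
proof (rule poly_mapping_eqI)
  fix k
  have "(\<Sum>t\<in>Poly_Mapping.keys p. Poly_Mapping.lookup p t when t = k) = Poly_Mapping.lookup p k"
    by (cases "k \<in> Poly_Mapping.keys p")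
      (auto simp: when_def in_keys_iff sum.delta)
  then show "Poly_Mapping.lookup p k = Poly_Mapping.lookup
      (\<Sum>t\<in>Poly_Mapping.keys p. Poly_Mapping.single t (Poly_Mapping.lookup p t)) k"
    by (simp add: lookup_sum lookup_single)
qed

text \<open>Only the terms that occur in \<open>p\<close> itself have to be treated, so that conditions on the support of
  \<open>p\<close> are at hand in the second case.\<close>

lemma poly_mapping_add_induct [case_names zero single add]:
  fixes p :: "'a \<Rightarrow>\<^sub>0 'b::comm_monoid_add"
  assumes "P 0"
    and single: "\<And>t. t \<in> Poly_Mapping.keys p \<Longrightarrow> P (Poly_Mapping.single t (Poly_Mapping.lookup p t))"
    and add: "\<And>q q'. P q \<Longrightarrow> P q' \<Longrightarrow> P (q + q')"
  shows "P p"
proof -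
  have "P (\<Sum>t\<in>K. Poly_Mapping.single t (Poly_Mapping.lookup p t))"
    if "finite K" "K \<subseteq> Poly_Mapping.keys p" for K
    using that by (induction K) (auto simp: assms)
  from this[of "Poly_Mapping.keys p"] show ?thesis
    by (simp flip: poly_mapping_sum_singles)
qed

lemma subst_0 [simp]: "subst \<phi> 0 = 0"
  by (simp add: subst_def)

lemma subst_single: "subst \<phi> (Poly_Mapping.single t c) = Const c * monomial_value \<phi> t"
  by (cases "c = 0") (simp_all add: subst_def)

lemma subst_add: "subst \<phi> (p + q) = subst \<phi> p + subst \<phi> q"
  unfolding subst_def
  by (rule setsum_keys_plus_distrib) (simp_all add: distrib_right)

lemma subst_Const [simp]: "subst \<phi> (Const c) = Const c"
  unfolding Const_def[of c] subst_single by (simp add: Const_def)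

lemma subst_1 [simp]: "subst \<phi> 1 = 1"
  using subst_Const[of \<phi> 1] by simp

lemma subst_Var [simp]: "subst \<phi> (Var v) = \<phi> v"
  by (simp add: Var_def subst_single)

lemma subst_mult: "subst \<phi> (p * q) = subst \<phi> p * subst \<phi> q"
proof (induction p rule: poly_mapping_add_induct)
  case (single s)
  show ?case
  proof (induction q rule: poly_mapping_add_induct)
    case (single t)
    show ?case by (simp add: mult_single subst_single monomial_value_add)
  qed (simp_all add: distrib_left subst_add)
qed (simp_all add: distrib_right subst_add)

lemma subst_uminus: "subst \<phi> (- p) = - subst \<phi> p"
  using subst_add[of \<phi> p "- p"] by (simp add: eq_neg_iff_add_eq_0 add.commute)

lemma subst_diff: "subst \<phi> (p - q) = subst \<phi> p - subst \<phi> q"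
  using subst_add[of \<phi> p "- q"] by (simp add: subst_uminus)

lemma subst_sum: "subst \<phi> (sum f A) = (\<Sum>x\<in>A. subst \<phi> (f x))"
  by (induction A rule: infinite_finite_induct) (simp_all add: subst_add)

lemma single_eq_Const_mult: "Poly_Mapping.single t c = Const c * Poly_Mapping.single t (1::'r::comm_ring_1)"
  by (simp add: Const_def mult_single)

lemma single_eq_monomial_value:
  "Poly_Mapping.single t (1::'r::comm_ring_1) = monomial_value Var t"
proof (induction t rule: poly_mapping_add_induct)
  case (single v)
  have "Poly_Mapping.single (Poly_Mapping.single v n) (1::'r) = Var v ^ n" for n
  proof (induction n)
    case (Suc n)
    have "Poly_Mapping.single v (Suc n) = Poly_Mapping.single v 1 + Poly_Mapping.single v n"
      by (simp flip: single_add)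
    moreover have "Poly_Mapping.single (Poly_Mapping.single v 1 + Poly_Mapping.single v n) (1::'r) =
        Var v * Poly_Mapping.single (Poly_Mapping.single v n) 1"
      by (simp add: Var_def mult_single)
    ultimately show ?case using Suc by simp
  qed simp
  then show ?case by simp
next
  case (add q q')
  moreover have "Poly_Mapping.single (q + q') (1::'r) =
      Poly_Mapping.single q 1 * Poly_Mapping.single q' 1"
    by (simp add: mult_single)
  ultimately show ?case by (simp add: monomial_value_add)
qed simp

lemma indets_0 [simp]: "indets 0 = {}"
  by (simp add: indets_def)

lemma indets_Const [simp]: "indets (Const c) = {}"
  by (auto simp: indets_def Const_def)

lemma indets_1 [simp]: "indets (1 :: ('v, 'r::comm_ring_1) mpol) = {}"
  by (simp add: indets_def)

lemma indets_Var [simp]: "indets (Var v :: ('v, 'r::comm_ring_1) mpol) = {v}"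
  by (simp add: indets_def Var_def)

lemma indets_add: "indets p \<subseteq> I \<Longrightarrow> indets q \<subseteq> I \<Longrightarrow> indets (p + q) \<subseteq> I"
  unfolding indets_def using keys_add[of p q] by blast

lemma indets_uminus [simp]: "indets (- p :: ('v, 'r::comm_ring_1) mpol) = indets p"
  by (simp add: indets_def)

lemma indets_diff:
  "indets (p :: ('v, 'r::comm_ring_1) mpol) \<subseteq> I \<Longrightarrow> indets q \<subseteq> I \<Longrightarrow> indets (p - q) \<subseteq> I"
  using indets_add[of p I "- q"] by simp

lemma indets_mult:
  assumes "indets p \<subseteq> I" "indets q \<subseteq> I"
  shows "indets (p * q) \<subseteq> I"
proof
  fix v assume "v \<in> indets (p * q)"
  then obtain t where "t \<in> Poly_Mapping.keys (p * q)" and v: "v \<in> Poly_Mapping.keys t"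
    by (auto simp: indets_def)
  then obtain a b where "t = a + b" and ab: "a \<in> Poly_Mapping.keys p" "b \<in> Poly_Mapping.keys q"
    using keys_mult[of p q] by blast
  then have "v \<in> Poly_Mapping.keys a \<or> v \<in> Poly_Mapping.keys b"
    using v keys_add[of a b] by blast
  then show "v \<in> I" using ab assms by (auto simp: indets_def)
qed

lemma indets_sum:
  "(\<And>x. x \<in> A \<Longrightarrow> indets (f x) \<subseteq> I) \<Longrightarrow> indets (sum f A :: ('v, 'r::comm_ring_1) mpol) \<subseteq> I"
  by (induction A rule: infinite_finite_induct) (simp_all add: indets_add)

text \<open>A property of the polynomials in the variables \<open>I\<close> has to be checked only on the generators of the
  polynomial algebra.\<close>

lemma mpol_induct [consumes 1, case_names Const Var add mult]:
  fixes p :: "('v, 'r::comm_ring_1) mpol"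
  assumes p: "indets p \<subseteq> I"
    and Const: "\<And>c. P (Const c)" and Var: "\<And>v. v \<in> I \<Longrightarrow> P (Var v)"
    and add: "\<And>q q'. indets q \<subseteq> I \<Longrightarrow> indets q' \<subseteq> I \<Longrightarrow> P q \<Longrightarrow> P q' \<Longrightarrow> P (q + q')"
    and mult: "\<And>q q'. indets q \<subseteq> I \<Longrightarrow> indets q' \<subseteq> I \<Longrightarrow> P q \<Longrightarrow> P q' \<Longrightarrow> P (q * q')"
  shows "P p"
proof -
  define Q where "Q q \<longleftrightarrow> indets q \<subseteq> I \<and> P q" for q
  have Q_mult: "Q (q * q')" if "Q q" "Q q'" for q q'
    using that mult by (simp add: Q_def indets_mult)
  have Q_Const: "Q (Const c)" for c using Const by (simp add: Q_def)
  have Q_power: "Q (Var v ^ n)" if "v \<in> I" for v n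
    using that Q_mult Q_Const[of 1] Var by (induction n) (simp_all add: Q_def)
  have Q_prod: "Q (\<Prod>v\<in>K. Var v ^ e v)" if "finite K" "K \<subseteq> I" for K e
    using that Q_mult Q_Const[of 1] Q_power by (induction K) auto
  have "Q p"
  proof (induction p rule: poly_mapping_add_induct)
    case zero
    show ?case using Q_Const[of 0] by simp
  next
    case (single t)
    then have "Poly_Mapping.keys t \<subseteq> I" using p by (auto simp: indets_def)
    then show ?case
      by (subst single_eq_Const_mult)
        (simp add: Q_mult Q_Const Q_prod single_eq_monomial_value monomial_value_def)
  next
    case (add q q')
    then show ?case using assms(4) by (simp add: Q_def indets_add)
  qed
  then show ?thesis by (simp add: Q_def)
qed

lemma mpol_alg_simps [simp]:
  "carrier (mpol_alg I) = {p. indets p \<subseteq> I}" "\<one>\<^bsub>mpol_alg I\<^esub> = 1" "\<zero>\<^bsub>mpol_alg I\<^esub> = 0"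
  "p \<otimes>\<^bsub>mpol_alg I\<^esub> q = p * q" "p \<oplus>\<^bsub>mpol_alg I\<^esub> q = p + q" "r \<odot>\<^bsub>mpol_alg I\<^esub> p = Const r * p"
  by (simp_all add: mpol_alg_def)

lemma cring_mpol_alg: "cring (mpol_alg I :: ('r::comm_ring_1, ('v, 'r) mpol) module)"
proof (rule cringI)
  show "abelian_group (mpol_alg I :: ('r, ('v, 'r) mpol) module)"
  proof (rule abelian_groupI)
    fix p :: "('v, 'r) mpol"
    assume "p \<in> carrier (mpol_alg I)"
    then show "\<exists>q\<in>carrier (mpol_alg I). q \<oplus>\<^bsub>mpol_alg I\<^esub> p = \<zero>\<^bsub>mpol_alg I\<^esub>"
      by (intro bexI[of _ "- p"]) simp_all
  qed (simp_all add: indets_add ac_simps)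
  show "comm_monoid (mpol_alg I :: ('r, ('v, 'r) mpol) module)"
    by (rule comm_monoidI) (simp_all add: indets_mult ac_simps)
qed (simp add: distrib_right)

lemma a_inv_mpol_alg [simp]:
  "indets p \<subseteq> I \<Longrightarrow> \<ominus>\<^bsub>mpol_alg I\<^esub> p = - (p :: ('v, 'r::comm_ring_1) mpol)"
proof -
  interpret cring "mpol_alg I :: ('r, ('v, 'r) mpol) module" by (rule cring_mpol_alg)
  show "indets p \<subseteq> I \<Longrightarrow> \<ominus>\<^bsub>mpol_alg I\<^esub> p = - p"
    by (rule sum_zero_eq_neg[symmetric]) simp_all
qed

lemma a_minus_mpol_alg [simp]:
  "indets q \<subseteq> I \<Longrightarrow> p \<ominus>\<^bsub>mpol_alg I\<^esub> q = p - (q :: ('v, 'r::comm_ring_1) mpol)"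
  by (simp add: a_minus_def)

lemma indets_subst:
  assumes "indets p \<subseteq> I" "\<And>v. v \<in> I \<Longrightarrow> indets (\<phi> v) \<subseteq> J"
  shows "indets (subst \<phi> p) \<subseteq> J"
  using assms(1)
  by (induction rule: mpol_induct) (simp_all add: assms(2) subst_add subst_mult indets_add indets_mult)

lemma subst_cong:
  assumes "indets p \<subseteq> I" "\<And>v. v \<in> I \<Longrightarrow> \<phi> v = \<psi> v"
  shows "subst \<phi> p = subst \<psi> p"
  using assms(1) by (induction rule: mpol_induct) (simp_all add: assms(2) subst_add subst_mult)

lemma subst_subst: "subst \<phi> (subst \<psi> p) = subst (\<lambda>v. subst \<phi> (\<psi> v)) p"
proof -
  have "indets p \<subseteq> UNIV" by simp
  then show ?thesis by (induction rule: mpol_induct) (simp_all add: subst_add subst_mult)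
qed

lemma subst_Var_id: "subst Var p = p"
proof -
  have "indets p \<subseteq> UNIV" by simp
  then show ?thesis by (induction rule: mpol_induct) (simp_all add: subst_add subst_mult)
qed

lemma subst_alg_hom:
  assumes "\<And>v. v \<in> I \<Longrightarrow> indets (\<phi> v) \<subseteq> J"
  shows "subst \<phi> \<in> alg_hom (mpol_alg I) (mpol_alg J)"
proof -
  have "indets (subst \<phi> p) \<subseteq> J" if "indets p \<subseteq> I" for p
    using indets_subst that assms by blast
  then show ?thesis
    unfolding alg_hom_def Ring.ring_hom_def by (simp add: Pi_iff subst_add subst_mult)
qed

text \<open>Since \<^const>\<open>generate_ring\<close> closes under the ring operations and the constants are among the generators,
  the generated subalgebra consists of the values of polynomials.\<close>

lemma subst_image:
  assumes "\<And>v. v \<in> I \<Longrightarrow> indets (\<phi> v) \<subseteq> J"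
  shows "subst \<phi> ` carrier (mpol_alg I :: ('r::comm_ring_1, ('v, 'r) mpol) module) =
    subalg_gen J (\<phi> ` I)"
proof
  show "subst \<phi> ` carrier (mpol_alg I :: ('r, ('v, 'r) mpol) module) \<subseteq> subalg_gen J (\<phi> ` I)"
  proof clarsimp
    fix p :: "('v, 'r) mpol" assume "indets p \<subseteq> I"
    then show "subst \<phi> p \<in> subalg_gen J (\<phi> ` I)"
      unfolding subalg_gen_def
    proof (induction rule: mpol_induct)
      case (add q q')
      then show ?case using generate_ring.eng_add[OF add(3,4)] by (simp add: subst_add)
    next
      case (mult q q')
      then show ?case using generate_ring.eng_mult[OF mult(3,4)] by (simp add: subst_mult)
    qed (auto intro: generate_ring.incl)
  qed
next
  let ?C = "{p::('v, 'r) mpol. indets p \<subseteq> I}"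
  have "q \<in> subst \<phi> ` ?C \<and> indets q \<subseteq> J" if "q \<in> subalg_gen J (\<phi> ` I)" for q
    using that unfolding subalg_gen_def
  proof (induction rule: generate_ring.induct)
    case one
    show ?case by (auto intro!: image_eqI[of _ _ 1])
  next
    case (incl h)
    then consider c where "h = Const c" | v where "v \<in> I" "h = \<phi> v" by auto
    then show ?case
    proof cases
      case 1
      then show ?thesis by (auto intro!: image_eqI[of _ _ "Const c"])
    next
      case 2
      then show ?thesis using assms by (auto intro!: image_eqI[of _ _ "Var v"] dest: subsetD)
    qed
  next
    case (a_inv h)
    then obtain p where "indets p \<subseteq> I" "h = subst \<phi> p" by auto
    then show ?case using a_inv by (auto intro!: image_eqI[of _ _ "- p"] simp: subst_uminus)
  next
    case (eng_add h h')
    then obtain p p' where "indets p \<subseteq> I" "h = subst \<phi> p" "indets p' \<subseteq> I" "h' = subst \<phi> p'" by auto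
    then show ?case using eng_add
      by (simp add: indets_add image_eqI[of _ _ "p + p'"] subst_add)
  next
    case (eng_mult h h')
    then obtain p p' where "indets p \<subseteq> I" "h = subst \<phi> p" "indets p' \<subseteq> I" "h' = subst \<phi> p'" by auto
    then show ?case using eng_mult
      by (simp add: indets_mult image_eqI[of _ _ "p * p'"] subst_mult)
  qed
  then show "subalg_gen J (\<phi> ` I) \<subseteq> subst \<phi> ` carrier (mpol_alg I :: ('r, ('v, 'r) mpol) module)"
    by auto
qed

lemma subalg_gen_mono:
  assumes "S \<subseteq> subalg_gen I T"
  shows "subalg_gen I S \<subseteq> subalg_gen I T"
proof
  fix q assume "q \<in> subalg_gen I S"
  then show "q \<in> subalg_gen I T"
    unfolding subalg_gen_def
  proof (induction rule: generate_ring.induct)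
    case (incl h)
    then show ?case using assms by (auto simp: subalg_gen_def intro: generate_ring.incl)
  next
    case one
    show ?case by (rule generate_ring.one)
  next
    case (a_inv h)
    show ?case using a_inv.IH by (rule generate_ring.a_inv)
  next
    case (eng_add h h')
    show ?case using eng_add.IH by (rule generate_ring.eng_add)
  next
    case (eng_mult h h')
    show ?case using eng_mult.IH by (rule generate_ring.eng_mult)
  qed
qed

lemma subalg_gen_Const: "Const r \<in> subalg_gen I S"
  by (auto simp: subalg_gen_def intro: generate_ring.incl)

lemma subalg_gen_incl: "q \<in> S \<Longrightarrow> q \<in> subalg_gen I S"
  by (auto simp: subalg_gen_def intro: generate_ring.incl)

lemma subalg_gen_add: "p \<in> subalg_gen I S \<Longrightarrow> q \<in> subalg_gen I S \<Longrightarrow> p + q \<in> subalg_gen I S"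
  unfolding subalg_gen_def using generate_ring.eng_add[of p "mpol_alg I" _ q] by simp

lemma subalg_gen_mult: "p \<in> subalg_gen I S \<Longrightarrow> q \<in> subalg_gen I S \<Longrightarrow> p * q \<in> subalg_gen I S"
  unfolding subalg_gen_def using generate_ring.eng_mult[of p "mpol_alg I" _ q] by simp

lemma subalg_gen_0: "0 \<in> subalg_gen I S"
  using subalg_gen_Const[of 0] by simp

lemma subalg_gen_sum:
  "(\<And>x. x \<in> A \<Longrightarrow> f x \<in> subalg_gen I S) \<Longrightarrow> sum f A \<in> subalg_gen I S"
  by (induction A rule: infinite_finite_induct) (simp_all add: subalg_gen_0 subalg_gen_add)

lemma genideal_subst_eq_0:
  fixes G :: "('v, 'r::comm_ring_1) mpol set"
  assumes G: "\<And>g. g \<in> G \<Longrightarrow> indets g \<subseteq> I" "\<And>g. g \<in> G \<Longrightarrow> subst \<phi> g = 0"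
    and p: "p \<in> Idl\<^bsub>mpol_alg I\<^esub> G"
  shows "subst \<phi> p = 0"
proof -
  interpret cring "mpol_alg I :: ('r, ('v, 'r) mpol) module" by (rule cring_mpol_alg)
  let ?K = "{q. indets q \<subseteq> I \<and> subst \<phi> q = 0}"
  have "ideal ?K (mpol_alg I)"
  proof (rule idealI[OF ring_axioms])
    show "subgroup ?K (add_monoid (mpol_alg I))"
    proof (rule add.subgroupI)
      have "0 \<in> ?K" by simp
      then show "?K \<noteq> {}" by (metis empty_iff)
      show "?K \<subseteq> carrier (mpol_alg I)" by (simp add: Collect_mono)
    next
      fix q assume "q \<in> ?K"
      then show "\<ominus>\<^bsub>mpol_alg I\<^esub> q \<in> ?K" by (simp add: subst_uminus)
    qed (simp_all add: subst_add indets_add)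
  qed (simp_all add: subst_mult indets_mult)
  then have "Idl\<^bsub>mpol_alg I\<^esub> G \<subseteq> ?K" using G by (intro genideal_minimal) (simp_all add: subset_iff)
  then show ?thesis using p by blast
qed

text \<open>Congruence calculus modulo an ideal of a polynomial algebra. It serves both the relations of a
  symmetric algebra and the minors of a scroll.\<close>

locale poly_ideal =
  fixes I :: "'v set" and J :: "('v, 'r::comm_ring_1) mpol set"
  assumes ideal: "ideal J (mpol_alg I)"
begin

abbreviation cong :: "('v, 'r) mpol \<Rightarrow> ('v, 'r) mpol \<Rightarrow> bool" (infix \<open>\<approx>\<^sub>J\<close> 50) where
  "p \<approx>\<^sub>J q \<equiv> p - q \<in> J"

lemma mem_add: "p \<in> J \<Longrightarrow> q \<in> J \<Longrightarrow> p + q \<in> J"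
  using additive_subgroup.a_closed[OF ideal.axioms(1)[OF ideal], of p q] by simp

lemma mem_mult: "p \<in> J \<Longrightarrow> indets q \<subseteq> I \<Longrightarrow> q * p \<in> J"
  using ideal.I_l_closed[OF ideal, of p q] by simp

lemma cong_refl: "p \<approx>\<^sub>J p"
  using additive_subgroup.zero_closed[OF ideal.axioms(1)[OF ideal]] by simp

lemma cong_sym: "p \<approx>\<^sub>J q \<Longrightarrow> q \<approx>\<^sub>J p"
  using mem_mult[of "p - q" "- 1"] by simp

lemma cong_trans: "p \<approx>\<^sub>J q \<Longrightarrow> q \<approx>\<^sub>J q' \<Longrightarrow> p \<approx>\<^sub>J q'"
  using mem_add[of "p - q" "q - q'"] by simp

lemma cong_add: "p \<approx>\<^sub>J q \<Longrightarrow> p' \<approx>\<^sub>J q' \<Longrightarrow> p + p' \<approx>\<^sub>J q + q'"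
  using mem_add[of "p - q" "p' - q'"] by (simp add: algebra_simps)

lemma cong_mult_left: "p \<approx>\<^sub>J q \<Longrightarrow> indets a \<subseteq> I \<Longrightarrow> a * p \<approx>\<^sub>J a * q"
  using mem_mult[of "p - q" a] by (simp add: algebra_simps)

lemma cong_mult:
  assumes "p \<approx>\<^sub>J q" "p' \<approx>\<^sub>J q'" "indets p \<subseteq> I" "indets q' \<subseteq> I"
  shows "p * p' \<approx>\<^sub>J q * q'"
proof -
  have "p * (p' - q') + q' * (p - q) \<in> J"
    using assms by (intro mem_add mem_mult)
  then show ?thesis by (simp add: algebra_simps)
qed

end

section \<open>Quotients of algebras and the Rees algebra\<close>

lemma alg_homD:
  assumes "h \<in> alg_hom A B"
  shows "a \<in> carrier A \<Longrightarrow> h a \<in> carrier B"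
    "a \<in> carrier A \<Longrightarrow> b \<in> carrier A \<Longrightarrow> h (a \<otimes>\<^bsub>A\<^esub> b) = h a \<otimes>\<^bsub>B\<^esub> h b"
    "a \<in> carrier A \<Longrightarrow> b \<in> carrier A \<Longrightarrow> h (a \<oplus>\<^bsub>A\<^esub> b) = h a \<oplus>\<^bsub>B\<^esub> h b"
    "h \<one>\<^bsub>A\<^esub> = \<one>\<^bsub>B\<^esub>" "a \<in> carrier A \<Longrightarrow> h (r \<odot>\<^bsub>A\<^esub> a) = r \<odot>\<^bsub>B\<^esub> h a"
  using assms by (auto simp: alg_hom_def Ring.ring_hom_def)

lemma alg_homI:
  assumes "\<And>a. a \<in> carrier A \<Longrightarrow> h a \<in> carrier B"
    "\<And>a b. a \<in> carrier A \<Longrightarrow> b \<in> carrier A \<Longrightarrow> h (a \<otimes>\<^bsub>A\<^esub> b) = h a \<otimes>\<^bsub>B\<^esub> h b"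
    "\<And>a b. a \<in> carrier A \<Longrightarrow> b \<in> carrier A \<Longrightarrow> h (a \<oplus>\<^bsub>A\<^esub> b) = h a \<oplus>\<^bsub>B\<^esub> h b"
    "h \<one>\<^bsub>A\<^esub> = \<one>\<^bsub>B\<^esub>" "\<And>r a. a \<in> carrier A \<Longrightarrow> h (r \<odot>\<^bsub>A\<^esub> a) = r \<odot>\<^bsub>B\<^esub> h a"
  shows "h \<in> alg_hom A B"
  using assms by (auto simp: alg_hom_def Ring.ring_hom_def)

lemma alg_hom_comp:
  assumes "g \<in> alg_hom A B" "h \<in> alg_hom B C"
  shows "(\<lambda>a. h (g a)) \<in> alg_hom A C"
  using alg_homD[OF assms(1)] alg_homD[OF assms(2)] by (intro alg_homI) simp_all

text \<open>A quotient built by \<^const>\<open>quot_module\<close> has the ring operations of \<open>Quot\<close>, but is a record with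
  an additional field for scalar multiplication; the ring axioms have to be transported.\<close>

lemma cring_record_cong:
  assumes "cring A" "carrier B = carrier A" "monoid.mult B = monoid.mult A" "one B = one A"
    "ring.zero B = ring.zero A" "add B = add A"
  shows "cring B"
  using assms(1) unfolding cring_def ring_def abelian_group_def abelian_monoid_def
    abelian_group_axioms_def comm_group_def comm_monoid_def comm_monoid_axioms_def
    ring_axioms_def monoid_def group_def group_axioms_def Units_def
  unfolding assms(2-) partial_object.simps monoid.simps by assumption

text \<open>Scalars act through their images \<open>r \<odot> \<one>\<close>. This form of the axioms passes to quotients,
  and it does not need the scalars, which form a type, to be a ring in the sense of a record.\<close>

locale ralgebra = cring A for A :: "('r::comm_ring_1, 'a) module" (structure) +
  assumes smult_one_closed: "r \<odot> \<one> \<in> carrier A"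
    and smult_conv: "a \<in> carrier A \<Longrightarrow> r \<odot> a = (r \<odot> \<one>) \<otimes> a"
    and smult_assoc_one: "(r * r') \<odot> \<one> = (r \<odot> \<one>) \<otimes> (r' \<odot> \<one>)"
begin

lemma smult_closed: "a \<in> carrier A \<Longrightarrow> r \<odot> a \<in> carrier A"
  by (subst smult_conv) (simp_all add: smult_one_closed)

lemma smult_assoc: "a \<in> carrier A \<Longrightarrow> (r * r') \<odot> a = r \<odot> (r' \<odot> a)"
  by (simp add: smult_conv[of a] smult_conv[of "_ \<otimes> _"] smult_one_closed smult_assoc_one m_assoc)

lemma smult_add: "a \<in> carrier A \<Longrightarrow> b \<in> carrier A \<Longrightarrow> r \<odot> (a \<oplus> b) = r \<odot> a \<oplus> r \<odot> b"
  by (simp add: smult_conv[of a] smult_conv[of b] smult_conv[of "_ \<oplus> _"] smult_one_closed r_distr)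

lemma smult_zero: "r \<odot> \<zero> = \<zero>"
  by (simp add: smult_conv[of \<zero>] smult_one_closed)

lemma smult_mult: "a \<in> carrier A \<Longrightarrow> b \<in> carrier A \<Longrightarrow> r \<odot> (a \<otimes> b) = a \<otimes> (r \<odot> b)"
  by (simp add: smult_conv[of b] smult_conv[of "_ \<otimes> _"] smult_one_closed m_lcomm)

lemma smult_inv: "a \<in> carrier A \<Longrightarrow> r \<odot> (\<ominus> a) = \<ominus> (r \<odot> a)"
  by (simp add: smult_conv[of a] smult_conv[of "\<ominus> _"] smult_one_closed r_minus)

lemma quot_module_simps:
  "carrier (quot_module A J) = a_rcosets J" "\<one>\<^bsub>quot_module A J\<^esub> = J +> \<one>"
  "\<zero>\<^bsub>quot_module A J\<^esub> = J" "Y \<oplus>\<^bsub>quot_module A J\<^esub> Z = set_add A Y Z"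
  "Y \<otimes>\<^bsub>quot_module A J\<^esub> Z = rcoset_mult A J Y Z"
  by (simp_all add: quot_module_def)

lemma quot_smult:
  assumes "ideal J A" "a \<in> carrier A"
  shows "r \<odot>\<^bsub>quot_module A J\<^esub> (J +> a) = J +> (r \<odot> a)"
proof -
  interpret J: ideal J A by fact
  have "J +> (r \<odot> x) = J +> (r \<odot> a)" if x: "x \<in> J +> a" for x
  proof -
    obtain j where j: "j \<in> J" "x = j \<oplus> a" using x by (auto simp: a_r_coset_def')
    have "j \<in> carrier A" using j J.Icarr by blast
    then have "r \<odot> x = r \<odot> j \<oplus> r \<odot> a" using assms j by (simp add: smult_add)
    moreover have rj: "r \<odot> j \<in> J"
      using \<open>j \<in> carrier A\<close> j J.I_l_closed smult_one_closed by (simp add: smult_conv[of j])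
    moreover have "J +> (r \<odot> j \<oplus> r \<odot> a) = (J +> (r \<odot> j)) +> (r \<odot> a)"
      using assms smult_closed J.Icarr[OF rj] by (simp add: J.a_subset a_coset_add_assoc)
    ultimately show ?thesis using a_rcos_zero[OF assms(1) rj] by simp
  qed
  moreover have "a \<in> J +> a"
    using assms J.a_rcos_self by blast
  ultimately have "(\<Union>x\<in>J +> a. J +> (r \<odot> x)) = J +> (r \<odot> a)"
    using UN_constant_eq[of a "J +> a" "\<lambda>x. J +> (r \<odot> x)"] by blast
  then show ?thesis by (simp add: quot_module_def)
qed

lemma proj_alg_hom:
  assumes "ideal J A"
  shows "(\<lambda>a. J +> a) \<in> alg_hom A (quot_module A J)"
  using assms ideal.a_rcos_sum[OF assms] ideal.rcoset_mult_add[OF assms]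
    a_rcosetsI[OF additive_subgroup.a_subset[OF ideal.axioms(1)[OF assms]]]
  unfolding alg_hom_def Ring.ring_hom_def by (simp add: quot_module_simps quot_smult)

lemma proj_surj:
  assumes "ideal J A"
  shows "(\<lambda>a. J +> a) ` carrier A = carrier (quot_module A J)"
  by (auto simp: quot_module_simps A_RCOSETS_def')

lemma ralgebra_quotient:
  assumes "ideal J A"
  shows "ralgebra (quot_module A J)"
proof -
  have cring: "cring (quot_module A J)"
    using cring_record_cong[OF ideal.quotient_is_cring[OF assms cring_axioms], of "quot_module A J"]
    by (simp add: quot_module_def FactRing_def)
  note hom = proj_alg_hom[OF assms, unfolded alg_hom_def Ring.ring_hom_def, simplified]
  note surj = proj_surj[OF assms, symmetric]
  show ?thesis
  proof (intro ralgebra.intro cring ralgebra_axioms.intro)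
    fix r r' :: 'r and Y
    have one: "s \<odot>\<^bsub>quot_module A J\<^esub> \<one>\<^bsub>quot_module A J\<^esub> = J +> (s \<odot> \<one>)" for s
      using quot_smult[OF assms] by (simp add: quot_module_simps)
    show "r \<odot>\<^bsub>quot_module A J\<^esub> \<one>\<^bsub>quot_module A J\<^esub> \<in> carrier (quot_module A J)"
      unfolding one surj using smult_one_closed by blast
    show "r \<odot>\<^bsub>quot_module A J\<^esub> Y = (r \<odot>\<^bsub>quot_module A J\<^esub> \<one>\<^bsub>quot_module A J\<^esub>) \<otimes>\<^bsub>quot_module A J\<^esub> Y"
      if Y: "Y \<in> carrier (quot_module A J)"
    proof -
      obtain a where a: "a \<in> carrier A" "Y = J +> a"
        using Y unfolding surj by (rule imageE)
      then show ?thesis unfolding one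
        using ideal.rcoset_mult_add[OF assms smult_one_closed, of a r] quot_smult[OF assms]
        by (simp add: quot_module_simps smult_conv[of a r])
    qed
    show "(r * r') \<odot>\<^bsub>quot_module A J\<^esub> \<one>\<^bsub>quot_module A J\<^esub> =
        (r \<odot>\<^bsub>quot_module A J\<^esub> \<one>\<^bsub>quot_module A J\<^esub>) \<otimes>\<^bsub>quot_module A J\<^esub>
        (r' \<odot>\<^bsub>quot_module A J\<^esub> \<one>\<^bsub>quot_module A J\<^esub>)"
      unfolding one using ideal.rcoset_mult_add[OF assms smult_one_closed smult_one_closed]
      by (simp add: quot_module_simps smult_assoc_one)
  qed
qed

end

text \<open>The product of two nonzero annihilators annihilates the sum, and is nonzero over a domain.\<close>

lemma ideal_torsion:
  fixes A :: "('r::idom, 'a) module"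
  assumes "ralgebra A"
  shows "ideal (torsion A) A"
proof -
  interpret ralgebra A by fact
  have subgroup: "subgroup (torsion A) (add_monoid A)"
  proof (rule add.subgroupI)
    show "torsion A \<subseteq> carrier A" by (auto simp: torsion_def)
    have "\<zero>\<^bsub>A\<^esub> \<in> torsion A" by (auto simp: torsion_def smult_zero intro!: exI[of _ 1])
    then show "torsion A \<noteq> {}" by blast
    fix x assume x: "x \<in> torsion A"
    then show "\<ominus>\<^bsub>A\<^esub> x \<in> torsion A" by (auto simp: torsion_def smult_inv)
    fix y assume "y \<in> torsion A"
    then obtain r r' where r: "r \<noteq> 0" "r \<odot>\<^bsub>A\<^esub> x = \<zero>\<^bsub>A\<^esub>" "r' \<noteq> 0" "r' \<odot>\<^bsub>A\<^esub> y = \<zero>\<^bsub>A\<^esub>"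
      and xy: "x \<in> carrier A" "y \<in> carrier A"
      using x by (auto simp: torsion_def)
    have "(r' * r) \<odot>\<^bsub>A\<^esub> (x \<oplus>\<^bsub>A\<^esub> y) = (r' * r) \<odot>\<^bsub>A\<^esub> x \<oplus>\<^bsub>A\<^esub> (r * r') \<odot>\<^bsub>A\<^esub> y"
      using xy by (simp add: smult_add mult.commute)
    also have "\<dots> = \<zero>\<^bsub>A\<^esub>" using xy r by (simp only: smult_assoc) (simp add: smult_zero)
    finally show "x \<oplus>\<^bsub>A\<^esub> y \<in> torsion A"
      using xy r unfolding torsion_def by (auto intro!: exI[of _ "r' * r"])
  qed
  show ?thesis
  proof (rule idealI[OF ring_axioms subgroup])
    fix a x assume "a \<in> torsion A" and x: "x \<in> carrier A"
    then obtain r where r: "r \<noteq> 0" "r \<odot>\<^bsub>A\<^esub> a = \<zero>\<^bsub>A\<^esub>" and a: "a \<in> carrier A"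
      by (auto simp: torsion_def)
    then show xa: "x \<otimes>\<^bsub>A\<^esub> a \<in> torsion A"
      using x unfolding torsion_def by (auto intro!: exI[of _ r] simp: smult_mult)
    then show "a \<otimes>\<^bsub>A\<^esub> x \<in> torsion A" using a x by (simp add: m_comm)
  qed
qed

lemma ralgebra_mpol_alg: "ralgebra (mpol_alg I :: ('r::comm_ring_1, ('v, 'r) mpol) module)"
  by (rule ralgebra.intro[OF cring_mpol_alg]) (unfold_locales; simp)

text \<open>The Rees algebra is a quotient of a quotient. The composite of the two projections presents it
  directly as a quotient of the polynomial algebra with one variable for every element of \<open>E\<close>.\<close>

definition rees_proj :: "('r::idom, 'm) module \<Rightarrow> ('m, 'r) mpol \<Rightarrow> ('m, 'r) mpol set set" where
  "rees_proj E p = torsion (sym_alg E) +>\<^bsub>sym_alg E\<^esub>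
     (sym_rel E +>\<^bsub>mpol_alg (carrier E) :: ('r, ('m, 'r) mpol) module\<^esub> p)"

text \<open>The closure properties that make the defining relations of \<open>Sym(E)\<close> polynomials in the variables
  \<open>carrier E\<close>.\<close>

locale scalar_closed =
  fixes E :: "('r::idom, 'm) module"
  assumes add_closed: "\<And>x y. x \<in> carrier E \<Longrightarrow> y \<in> carrier E \<Longrightarrow> x \<oplus>\<^bsub>E\<^esub> y \<in> carrier E"
    and smult_closed: "\<And>r x. x \<in> carrier E \<Longrightarrow> r \<odot>\<^bsub>E\<^esub> x \<in> carrier E"
begin

abbreviation "Pol \<equiv> mpol_alg (carrier E) :: ('r, ('m, 'r) mpol) module"

lemma sym_gens_indets:
  "{Var (x \<oplus>\<^bsub>E\<^esub> y) - (Var x + Var y) | x y. x \<in> carrier E \<and> y \<in> carrier E} \<union>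
    {Var (r \<odot>\<^bsub>E\<^esub> x) - Const r * Var x | r x. x \<in> carrier E} \<subseteq>
    {p :: ('m, 'r) mpol. indets p \<subseteq> carrier E}"
proof safe
  fix x y z assume xy: "x \<in> carrier E" "y \<in> carrier E"
  assume z: "z \<in> indets (Var (x \<oplus>\<^bsub>E\<^esub> y) - (Var x + Var y) :: ('m, 'r) mpol)"
  have "indets (Var (x \<oplus>\<^bsub>E\<^esub> y) - (Var x + Var y) :: ('m, 'r) mpol) \<subseteq> carrier E"
    using xy by (simp add: indets_diff indets_add add_closed)
  then show "z \<in> carrier E" using z by (rule subsetD)
next
  fix r x z assume x: "x \<in> carrier E"
  assume z: "z \<in> indets (Var (r \<odot>\<^bsub>E\<^esub> x) - Const r * Var x :: ('m, 'r) mpol)"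
  have "indets (Var (r \<odot>\<^bsub>E\<^esub> x) - Const r * Var x :: ('m, 'r) mpol) \<subseteq> carrier E"
    using x by (simp add: indets_diff indets_mult smult_closed)
  then show "z \<in> carrier E" using z by (rule subsetD)
qed

lemma ideal_sym_rel: "ideal (sym_rel E) Pol"
proof -
  interpret cring Pol by (rule cring_mpol_alg)
  show ?thesis unfolding sym_rel_def
    by (rule genideal_ideal) (use sym_gens_indets in simp)
qed

lemma ralgebra_sym_alg: "ralgebra (sym_alg E)"
  unfolding sym_alg_def by (rule ralgebra.ralgebra_quotient[OF ralgebra_mpol_alg ideal_sym_rel])

lemma rees_proj_alg_hom: "rees_proj E \<in> alg_hom Pol (rees E)"
proof -
  have "(\<lambda>p. sym_rel E +>\<^bsub>Pol\<^esub> p) \<in> alg_hom Pol (sym_alg E)"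
    unfolding sym_alg_def by (rule ralgebra.proj_alg_hom[OF ralgebra_mpol_alg ideal_sym_rel])
  moreover have "(\<lambda>a. torsion (sym_alg E) +>\<^bsub>sym_alg E\<^esub> a) \<in> alg_hom (sym_alg E) (rees E)"
    unfolding rees_def
    by (rule ralgebra.proj_alg_hom[OF ralgebra_sym_alg ideal_torsion[OF ralgebra_sym_alg]])
  ultimately show ?thesis
    unfolding rees_proj_def by (rule alg_hom_comp)
qed

lemma rees_proj_surj: "rees_proj E ` carrier Pol = carrier (rees E)"
proof -
  have "carrier (sym_alg E) = (\<lambda>p. sym_rel E +>\<^bsub>Pol\<^esub> p) ` carrier Pol"
    unfolding sym_alg_def by (rule ralgebra.proj_surj[OF ralgebra_mpol_alg ideal_sym_rel, symmetric])
  moreover have "carrier (rees E) =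
      (\<lambda>a. torsion (sym_alg E) +>\<^bsub>sym_alg E\<^esub> a) ` carrier (sym_alg E)"
    unfolding rees_def
    by (rule ralgebra.proj_surj[OF ralgebra_sym_alg ideal_torsion[OF ralgebra_sym_alg], symmetric])
  ultimately show ?thesis by (simp add: image_image rees_proj_def)
qed

text \<open>The second projection kills the classes of \<open>Sym(E)\<close> that some nonzero scalar takes to zero.\<close>

lemma rees_proj_eq_iff:
  assumes "indets p \<subseteq> carrier E" "indets q \<subseteq> carrier E"
  shows "rees_proj E p = rees_proj E q \<longleftrightarrow> (\<exists>r. r \<noteq> 0 \<and> Const r * (p - q) \<in> sym_rel E)"
proof -
  interpret P: ralgebra Pol by (rule ralgebra_mpol_alg)
  interpret S: ralgebra "sym_alg E" by (rule ralgebra_sym_alg)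
  interpret J: ideal "sym_rel E" Pol by (rule ideal_sym_rel)
  interpret T: ideal "torsion (sym_alg E)" "sym_alg E" by (rule ideal_torsion[OF ralgebra_sym_alg])
  let ?c = "\<lambda>p. sym_rel E +>\<^bsub>Pol\<^esub> p"
  have hom: "?c \<in> alg_hom Pol (sym_alg E)"
    unfolding sym_alg_def by (rule ralgebra.proj_alg_hom[OF ralgebra_mpol_alg ideal_sym_rel])
  have carr: "?c x \<in> carrier (sym_alg E)" if "indets x \<subseteq> carrier E" for x
    using alg_homD(1)[OF hom] that by simp
  interpret h: ring_hom_cring Pol "sym_alg E" ?c
    using hom by (intro ring_hom_cringI ring_hom_ringI2 P.ring_axioms S.ring_axioms
        P.is_cring S.is_cring) (simp add: alg_hom_def)
  have pq: "indets (p - q) \<subseteq> carrier E" using assms by (rule indets_diff)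
  have "rees_proj E p = rees_proj E q \<longleftrightarrow> ?c p \<ominus>\<^bsub>sym_alg E\<^esub> ?c q \<in> torsion (sym_alg E)"
    unfolding rees_proj_def
    using S.quotient_eq_iff_same_a_r_cos[OF T.ideal_axioms carr carr] assms by simp
  also have "?c p \<ominus>\<^bsub>sym_alg E\<^esub> ?c q = ?c (p - q)"
    using assms h.hom_sub[of p q] by simp
  also have "?c (p - q) \<in> torsion (sym_alg E) \<longleftrightarrow>
      (\<exists>r. r \<noteq> 0 \<and> ?c (Const r * (p - q)) = sym_rel E)"
  proof -
    have smult: "r \<odot>\<^bsub>sym_alg E\<^esub> ?c (p - q) = ?c (Const r * (p - q))" for r
      using alg_homD(5)[OF hom, of "p - q" r, symmetric] pq unfolding mpol_alg_simps by blast
    have zero: "\<zero>\<^bsub>sym_alg E\<^esub> = sym_rel E" by (simp add: sym_alg_def P.quot_module_simps)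
    show ?thesis by (simp only: torsion_def mem_Collect_eq carr[OF pq] smult zero simp_thms)
  qed
  also have "\<dots> \<longleftrightarrow> (\<exists>r. r \<noteq> 0 \<and> Const r * (p - q) \<in> sym_rel E)"
  proof -
    have "indets (Const r * (p - q)) \<subseteq> carrier E" for r
      using pq by (simp add: indets_mult)
    then show ?thesis
      using J.rcos_const_imp_mem P.a_rcos_zero[OF J.ideal_axioms] by (metis mem_Collect_eq mpol_alg_simps(1))
  qed
  finally show ?thesis .
qed

lemma rees_in_conv: "rees_in E x = rees_proj E (Var x)"
  by (simp add: rees_in_def rees_proj_def)

end

text \<open>A homomorphism descends along a surjection with the same fibres. This is how maps out of a Rees
  algebra or a scroll are obtained.\<close>

lemma alg_hom_factor_surj:
  assumes \<pi>: "\<pi> \<in> alg_hom A B" "\<pi> ` carrier A = carrier B"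
    and \<epsilon>: "\<epsilon> \<in> alg_hom A C"
    and ker: "\<And>p q. p \<in> carrier A \<Longrightarrow> q \<in> carrier A \<Longrightarrow> \<pi> p = \<pi> q \<longleftrightarrow> \<epsilon> p = \<epsilon> q"
    and A: "ralgebra A"
  obtains g where "g \<in> alg_hom B C" "inj_on g (carrier B)" "\<And>p. p \<in> carrier A \<Longrightarrow> g (\<pi> p) = \<epsilon> p"
proof
  interpret A: ralgebra A by fact
  \<comment> \<open>Any preimage under \<open>\<pi>\<close> will do, since the fibres of \<open>\<pi>\<close> and \<open>\<epsilon>\<close> agree.\<close>
  define g where "g = \<epsilon> \<circ> inv_into (carrier A) \<pi>"
  show g: "g (\<pi> p) = \<epsilon> p" if "p \<in> carrier A" for p
  proof -
    have "\<pi> p \<in> \<pi> ` carrier A" using that by blast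
    then show ?thesis
      using that ker[of "inv_into (carrier A) \<pi> (\<pi> p)" p]
      by (simp add: g_def inv_into_into f_inv_into_f)
  qed
  have ex: "\<exists>p. p \<in> carrier A \<and> x = \<pi> p" if "x \<in> carrier B" for x
    using that unfolding \<pi>(2)[symmetric] by blast
  show "inj_on g (carrier B)"
  proof (rule inj_onI)
    fix x y assume xy: "x \<in> carrier B" "y \<in> carrier B" "g x = g y"
    obtain p where p: "p \<in> carrier A" "x = \<pi> p" using ex[OF xy(1)] by blast
    obtain q where q: "q \<in> carrier A" "y = \<pi> q" using ex[OF xy(2)] by blast
    show "x = y" using xy(3) ker[OF p(1) q(1)] g[OF p(1)] g[OF q(1)] p q by simp
  qed
  show "g \<in> alg_hom B C"
  proof (rule alg_homI)
    fix x assume "x \<in> carrier B"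
    then obtain p where p: "p \<in> carrier A" "x = \<pi> p" using ex by blast
    show "g x \<in> carrier C" using p g alg_homD(1)[OF \<epsilon>] by simp
    show "g (r \<odot>\<^bsub>B\<^esub> x) = r \<odot>\<^bsub>C\<^esub> g x" for r
      using p g[OF A.smult_closed[OF p(1), of r]] g[OF p(1)] alg_homD(5)[OF \<pi>(1) p(1)]
        alg_homD(5)[OF \<epsilon> p(1)] by simp
    fix y assume "y \<in> carrier B"
    then obtain q where q: "q \<in> carrier A" "y = \<pi> q" using ex by blast
    show "g (x \<otimes>\<^bsub>B\<^esub> y) = g x \<otimes>\<^bsub>C\<^esub> g y"
      using p q g[OF A.m_closed[OF p(1) q(1)]] g[OF p(1)] g[OF q(1)]
        alg_homD(2)[OF \<pi>(1) p(1) q(1)] alg_homD(2)[OF \<epsilon> p(1) q(1)] by simp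
    show "g (x \<oplus>\<^bsub>B\<^esub> y) = g x \<oplus>\<^bsub>C\<^esub> g y"
      using p q g[OF A.a_closed[OF p(1) q(1)]] g[OF p(1)] g[OF q(1)]
        alg_homD(3)[OF \<pi>(1) p(1) q(1)] alg_homD(3)[OF \<epsilon> p(1) q(1)] by simp
  next
    show "g \<one>\<^bsub>B\<^esub> = \<one>\<^bsub>C\<^esub>"
      using g[OF A.one_closed] alg_homD(4)[OF \<pi>(1)] alg_homD(4)[OF \<epsilon>] by simp
  qed
qed

text \<open>A homomorphism into \<open>C\<close> lifts along an injection whose image contains its image. All algebras
  compared below embed into one polynomial ring, and the maps between them arise in this way.\<close>

lemma alg_hom_lift_inj:
  assumes g: "g \<in> alg_hom A C" and g': "g' \<in> alg_hom B C" "inj_on g' (carrier B)"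
    and sub: "g ` carrier A \<subseteq> g' ` carrier B"
    and A: "ralgebra A" and B: "ralgebra B"
  obtains h where "h \<in> alg_hom A B" "\<And>a. a \<in> carrier A \<Longrightarrow> g' (h a) = g a"
proof
  interpret A: ralgebra A by fact
  interpret B: ralgebra B by fact
  define h where "h = inv_into (carrier B) g' \<circ> g"
  have h: "h a \<in> carrier B" "g' (h a) = g a" if "a \<in> carrier A" for a
  proof -
    have "g a \<in> g' ` carrier B" using that sub by blast
    then show "h a \<in> carrier B" "g' (h a) = g a"
      by (simp_all add: h_def inv_into_into f_inv_into_f)
  qed
  show "\<And>a. a \<in> carrier A \<Longrightarrow> g' (h a) = g a" by (rule h)
  note eqI = inj_onD[OF g'(2)]
  show "h \<in> alg_hom A B"
  proof (rule alg_homI)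
    show "h \<one>\<^bsub>A\<^esub> = \<one>\<^bsub>B\<^esub>"
      by (rule eqI) (simp_all add: h alg_homD(4)[OF g] alg_homD(4)[OF g'(1)])
    fix a assume a: "a \<in> carrier A"
    then show "h a \<in> carrier B" by (rule h)
    show "h (r \<odot>\<^bsub>A\<^esub> a) = r \<odot>\<^bsub>B\<^esub> h a" for r
      by (rule eqI) (simp_all add: a h alg_homD(5)[OF g] alg_homD(5)[OF g'(1)]
          A.smult_closed B.smult_closed)
    fix b assume b: "b \<in> carrier A"
    show "h (a \<otimes>\<^bsub>A\<^esub> b) = h a \<otimes>\<^bsub>B\<^esub> h b"
      by (rule eqI) (simp_all add: a b h alg_homD(2)[OF g] alg_homD(2)[OF g'(1)])
    show "h (a \<oplus>\<^bsub>A\<^esub> b) = h a \<oplus>\<^bsub>B\<^esub> h b"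
      by (rule eqI) (simp_all add: a b h alg_homD(3)[OF g] alg_homD(3)[OF g'(1)])
  qed
qed

lemma alg_iso_lift_inj:
  assumes g: "g \<in> alg_hom A C" "inj_on g (carrier A)" and g': "g' \<in> alg_hom B C" "inj_on g' (carrier B)"
    and image: "g ` carrier A = g' ` carrier B"
    and A: "ralgebra A" and B: "ralgebra B"
  obtains h where "h \<in> alg_iso A B" "\<And>a. a \<in> carrier A \<Longrightarrow> g' (h a) = g a"
proof -
  obtain h where h: "h \<in> alg_hom A B" "\<And>a. a \<in> carrier A \<Longrightarrow> g' (h a) = g a"
    using alg_hom_lift_inj[OF g(1) g' _ A B] image by auto
  have "bij_betw h (carrier A) (carrier B)"
    unfolding bij_betw_def
  proof (intro conjI equalityI subsetI)
    show "inj_on h (carrier A)"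
      using h(2) by (intro inj_onI inj_onD[OF g(2)]) metis+
    show "y \<in> carrier B" if "y \<in> h ` carrier A" for y
      using that alg_homD(1)[OF h(1)] by blast
    show "y \<in> h ` carrier A" if y: "y \<in> carrier B" for y
    proof -
      obtain a where a: "a \<in> carrier A" "g' y = g a" using y image by blast
      then have "y = h a"
        using h(2)[OF a(1)] alg_homD(1)[OF h(1) a(1)] y by (intro inj_onD[OF g'(2)]) simp_all
      then show ?thesis using a(1) by blast
    qed
  qed
  then show thesis using that h by (simp add: alg_iso_def)
qed

section \<open>The Rees algebra of a submodule of full rank of a free module\<close>

definition linear_form :: "nat \<Rightarrow> 'r::comm_ring_1 vec \<Rightarrow> (nat, 'r) mpol" where
  "linear_form s v = (\<Sum>i<s. Const (v $ i) * Var i)"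

lemma indets_linear_form: "indets (linear_form s v) \<subseteq> {..<s}"
  unfolding linear_form_def by (intro indets_sum indets_mult) auto

lemma linear_form_add:
  "v \<in> carrier_vec s \<Longrightarrow> w \<in> carrier_vec s \<Longrightarrow>
    linear_form s (v + w) = linear_form s v + linear_form s w"
  by (simp add: linear_form_def distrib_right sum.distrib)

lemma linear_form_smult:
  "v \<in> carrier_vec s \<Longrightarrow> linear_form s (r \<cdot>\<^sub>v v) = Const r * linear_form s v"
  by (simp add: linear_form_def sum_distrib_left mult.assoc)

lemma linear_form_smult_unit_vec:
  "i < s \<Longrightarrow> linear_form s (r \<cdot>\<^sub>v unit_vec s i) = Const r * Var i"
proof -
  assume i: "i < s"
  have "linear_form s (r \<cdot>\<^sub>v unit_vec s i) = (\<Sum>j<s. if j = i then Const r * Var i else 0)"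
    unfolding linear_form_def by (rule sum.cong) (use i in \<open>auto simp: unit_vec_def\<close>)
  also have "\<dots> = Const r * Var i" using i by simp
  finally show ?thesis .
qed

text \<open>Rescaling the variables multiplies the coefficient of a monomial by a monomial in the scalars,
  which is nonzero in a domain.\<close>

lemma inj_subst_scaled_vars:
  fixes c :: "nat \<Rightarrow> 'r::idom"
  assumes c: "\<And>i. i < s \<Longrightarrow> c i \<noteq> 0" and q: "indets q \<subseteq> {..<s}"
    and 0: "subst (\<lambda>i. Const (c i) * Var i) q = 0"
  shows "q = 0"
proof -
  have mono: "monomial_value (\<lambda>i. Const (c i) * Var i) t =
      Poly_Mapping.single t (monomial_value c t)" for t
  proof -
    have "monomial_value (\<lambda>i. Const (c i) * Var i) t =
        Const (monomial_value c t) * monomial_value Var t"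
      by (simp add: monomial_value_def power_mult_distrib prod.distrib)
    then show ?thesis
      by (simp add: Const_def mult_single flip: single_eq_monomial_value)
  qed
  have eq: "subst (\<lambda>i. Const (c i) * Var i) q = (\<Sum>t\<in>Poly_Mapping.keys q.
      Poly_Mapping.single t (Poly_Mapping.lookup q t * monomial_value c t))"
    unfolding subst_def mono by (simp add: Const_def mult_single)
  have "Poly_Mapping.lookup q t * monomial_value c t = 0" if "t \<in> Poly_Mapping.keys q" for t
  proof -
    have "Poly_Mapping.lookup (subst (\<lambda>i. Const (c i) * Var i) q) t =
        Poly_Mapping.lookup q t * monomial_value c t"
      unfolding eq lookup_sum lookup_single when_def using that by (simp only: sum.delta finite_keys if_True)
    then show ?thesis using 0 by simp
  qed
  moreover have "monomial_value c t \<noteq> 0" if "t \<in> Poly_Mapping.keys q" for t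
  proof -
    have "v < s" if "v \<in> Poly_Mapping.keys t" for v
      using q \<open>t \<in> Poly_Mapping.keys q\<close> that by (auto simp: indets_def)
    then show ?thesis by (simp add: monomial_value_def c)
  qed
  ultimately have "Poly_Mapping.lookup q t = 0" for t
    by (metis mult_eq_0_iff in_keys_iff)
  then show ?thesis by (simp add: poly_mapping_eqI)
qed

text \<open>A module \<open>N\<close> that is identified by \<open>\<Psi>\<close> with a submodule \<open>U\<close> of \<open>R\<^sup>s\<close>. The vectors
  \<open>c\<^sub>i e\<^sub>i\<close> witness that \<open>U\<close> has full rank.\<close>

locale full_rank_module =
  fixes N :: "('r::idom, 'm) module" and s :: nat and U :: "'r vec set"
    and \<Psi> :: "'r vec \<Rightarrow> 'm" and c :: "nat \<Rightarrow> 'r"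
  assumes U_carrier: "U \<subseteq> carrier_vec s"
    and U_add: "\<And>v w. v \<in> U \<Longrightarrow> w \<in> U \<Longrightarrow> v + w \<in> U"
    and U_smult: "\<And>r v. v \<in> U \<Longrightarrow> r \<cdot>\<^sub>v v \<in> U"
    and U_zero: "0\<^sub>v s \<in> U"
    and c_nonzero: "\<And>i. i < s \<Longrightarrow> c i \<noteq> 0"
    and c_unit_vec: "\<And>i. i < s \<Longrightarrow> c i \<cdot>\<^sub>v unit_vec s i \<in> U"
    and \<Psi>_bij: "bij_betw \<Psi> U (carrier N)"
    and \<Psi>_add: "\<And>v w. v \<in> U \<Longrightarrow> w \<in> U \<Longrightarrow> \<Psi> (v + w) = \<Psi> v \<oplus>\<^bsub>N\<^esub> \<Psi> w"
    and \<Psi>_smult: "\<And>r v. v \<in> U \<Longrightarrow> \<Psi> (r \<cdot>\<^sub>v v) = r \<odot>\<^bsub>N\<^esub> \<Psi> v"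
begin

lemma \<Psi>_cases:
  assumes "x \<in> carrier N"
  obtains v where "v \<in> U" "x = \<Psi> v"
  using assms \<Psi>_bij unfolding bij_betw_def by blast

lemma \<Psi>_closed: "v \<in> U \<Longrightarrow> \<Psi> v \<in> carrier N"
  using \<Psi>_bij by (rule bij_betwE[THEN bspec])

sublocale scalar_closed N
proof
  fix x assume x: "x \<in> carrier N"
  then obtain v where v: "v \<in> U" "x = \<Psi> v" by (rule \<Psi>_cases)
  show "r \<odot>\<^bsub>N\<^esub> x \<in> carrier N" for r
    using v by (simp add: U_smult \<Psi>_closed flip: \<Psi>_smult)
  fix y assume "y \<in> carrier N"
  then obtain w where w: "w \<in> U" "y = \<Psi> w" by (rule \<Psi>_cases)
  show "x \<oplus>\<^bsub>N\<^esub> y \<in> carrier N"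
    using v w by (simp add: U_add \<Psi>_closed flip: \<Psi>_add)
qed

definition form_of :: "'m \<Rightarrow> (nat, 'r) mpol" where
  "form_of x = linear_form s (inv_into U \<Psi> x)"

lemma form_of_\<Psi>: "v \<in> U \<Longrightarrow> form_of (\<Psi> v) = linear_form s v"
  using \<Psi>_bij by (simp add: form_of_def bij_betw_def)

lemma indets_form_of: "indets (form_of x) \<subseteq> {..<s}"
  by (simp add: form_of_def indets_linear_form)

lemma subst_sym_rel:
  assumes "p \<in> sym_rel N"
  shows "subst form_of p = 0"
  using assms unfolding sym_rel_def
proof (rule genideal_subst_eq_0[rotated 2], safe)
  fix x assume x: "x \<in> carrier N"
  then obtain v where v: "v \<in> U" "x = \<Psi> v" by (rule \<Psi>_cases)
  then have v': "v \<in> carrier_vec s" using U_carrier by blast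
  show "subst form_of (Var (r \<odot>\<^bsub>N\<^esub> x) - Const r * Var x) = 0" for r
    using v v' by (simp add: subst_diff subst_mult form_of_\<Psi> linear_form_smult U_smult flip: \<Psi>_smult)
  fix y assume y: "y \<in> carrier N"
  then obtain w where w: "w \<in> U" "y = \<Psi> w" by (rule \<Psi>_cases)
  then have w': "w \<in> carrier_vec s" using U_carrier by blast
  show "subst form_of (Var (x \<oplus>\<^bsub>N\<^esub> y) - (Var x + Var y)) = 0"
    using v v' w w' by (simp add: subst_diff subst_add form_of_\<Psi> linear_form_add U_add flip: \<Psi>_add)
qed (use sym_gens_indets in blast)+

sublocale poly_ideal "carrier N" "sym_rel N"
  by (rule poly_ideal.intro[OF ideal_sym_rel])

notation cong (infix \<open>\<approx>\<^sub>J\<close> 50)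

lemma rel_gens:
  assumes "x \<in> carrier N"
  shows "y \<in> carrier N \<Longrightarrow> Var (x \<oplus>\<^bsub>N\<^esub> y) \<approx>\<^sub>J Var x + Var y"
    and "Var (r \<odot>\<^bsub>N\<^esub> x) \<approx>\<^sub>J Const r * Var x"
proof -
  interpret P: cring Pol by (rule cring_mpol_alg)
  have sub: "{Var (x \<oplus>\<^bsub>N\<^esub> y) - (Var x + Var y) | x y. x \<in> carrier N \<and> y \<in> carrier N} \<union>
      {Var (r \<odot>\<^bsub>N\<^esub> x) - Const r * Var x | r x. x \<in> carrier N} \<subseteq> sym_rel N"
    unfolding sym_rel_def genideal_def by blast
  show "y \<in> carrier N \<Longrightarrow> Var (x \<oplus>\<^bsub>N\<^esub> y) \<approx>\<^sub>J Var x + Var y"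
    using sub assms by blast
  show "Var (r \<odot>\<^bsub>N\<^esub> x) \<approx>\<^sub>J Const r * Var x"
    using sub assms by blast
qed

definition gen :: "nat \<Rightarrow> 'm" where
  "gen i = \<Psi> (c i \<cdot>\<^sub>v unit_vec s i)"

lemma gen_closed: "i < s \<Longrightarrow> gen i \<in> carrier N"
  by (simp add: gen_def \<Psi>_closed c_unit_vec)

text \<open>In \<open>Sym(N)\<close> the variable of a linear combination of the \<open>c\<^sub>i e\<^sub>i\<close> is the combination of
  their variables. The summands are added one at a time, since the relations of \<open>Sym(N)\<close> only concern
  sums of two elements.\<close>

lemma \<Psi>_combination:
  assumes "k \<le> s"
  shows "vec s (\<lambda>i. if i < k then a i * c i else 0) \<in> U \<and>
    Var (\<Psi> (vec s (\<lambda>i. if i < k then a i * c i else 0))) \<approx>\<^sub>J (\<Sum>i<k. Const (a i) * Var (gen i))"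
  using assms
proof (induction k)
  case 0
  have z: "vec s (\<lambda>i. if i < 0 then a i * c i else 0) = 0\<^sub>v s" by (intro eq_vecI) auto
  have "\<Psi> (0\<^sub>v s) = 0 \<odot>\<^bsub>N\<^esub> \<Psi> (0\<^sub>v s)"
  proof -
    have "0 \<cdot>\<^sub>v 0\<^sub>v s = (0\<^sub>v s :: 'r vec)" by (intro eq_vecI) auto
    then show ?thesis using \<Psi>_smult[OF U_zero, of 0] by simp
  qed
  then have "Var (\<Psi> (0\<^sub>v s)) \<approx>\<^sub>J Const 0 * Var (\<Psi> (0\<^sub>v s))"
    using rel_gens(2)[OF \<Psi>_closed[OF U_zero], of 0] by simp
  then show ?case unfolding z by (simp add: U_zero)
next
  case (Suc k)
  let ?v = "vec s (\<lambda>i. if i < k then a i * c i else 0)"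
  let ?w = "a k \<cdot>\<^sub>v (c k \<cdot>\<^sub>v unit_vec s k)"
  have IH: "?v \<in> U" "Var (\<Psi> ?v) \<approx>\<^sub>J (\<Sum>i<k. Const (a i) * Var (gen i))"
    using Suc by simp_all
  have e: "vec s (\<lambda>i. if i < Suc k then a i * c i else 0) = ?v + ?w"
    by (intro eq_vecI) (auto simp: unit_vec_def less_Suc_eq)
  have k: "k < s" using Suc by simp
  have w: "?w \<in> U" using c_unit_vec[OF k] by (rule U_smult)
  have "Var (\<Psi> (?v + ?w)) \<approx>\<^sub>J Var (\<Psi> ?v) + Var (\<Psi> ?w)"
    unfolding \<Psi>_add[OF IH(1) w] by (intro rel_gens(1) \<Psi>_closed IH(1) w)
  moreover have "Var (\<Psi> ?w) \<approx>\<^sub>J Const (a k) * Var (gen k)"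
    unfolding gen_def \<Psi>_smult[OF c_unit_vec[OF k]] by (intro rel_gens(2) \<Psi>_closed c_unit_vec k)
  ultimately have "Var (\<Psi> (?v + ?w)) \<approx>\<^sub>J (\<Sum>i<k. Const (a i) * Var (gen i)) + Const (a k) * Var (gen k)"
    using cong_trans cong_add IH(2) by blast
  then show ?case unfolding e using U_add[OF IH(1) w] by simp
qed

text \<open>Up to torsion, \<open>Sym(N)\<close> is generated by the \<open>c\<^sub>i e\<^sub>i\<close>. For a variable the multiplier is the product
  of all \<open>c\<^sub>i\<close>; for sums and products of polynomials the multipliers are multiplied.\<close>

lemma common_denominator:
  assumes "indets p \<subseteq> carrier N"
  shows "\<exists>r q. r \<noteq> 0 \<and> indets q \<subseteq> {..<s} \<and> Const r * p \<approx>\<^sub>J subst (\<lambda>i. Var (gen i)) q"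
  using assms
proof (induction rule: mpol_induct)
  case (Const a)
  show ?case using cong_refl[of "Const a"]
    by (intro exI[of _ 1] exI[of _ "Const a"]) simp
next
  case (Var x)
  then obtain v where v: "v \<in> U" "x = \<Psi> v" by (rule \<Psi>_cases)
  \<comment> \<open>The coefficients are chosen such that \<open>a\<^sub>i c\<^sub>i = r v\<^sub>i\<close> with \<open>r\<close> the product of all \<open>c\<^sub>j\<close>.\<close>
  define r where "r = (\<Prod>i<s. c i)"
  define a where "a i = v $ i * (\<Prod>j\<in>{..<s} - {i}. c j)" for i
  have "a i * c i = r * v $ i" if "i < s" for i
    using that by (simp add: a_def r_def prod.remove[of "{..<s}" i] mult_ac)
  then have "r \<cdot>\<^sub>v v = vec s (\<lambda>i. if i < s then a i * c i else 0)"
    using v U_carrier by (intro eq_vecI) auto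
  then have 1: "Var (\<Psi> (r \<cdot>\<^sub>v v)) \<approx>\<^sub>J (\<Sum>i<s. Const (a i) * Var (gen i))"
    using \<Psi>_combination[of s a] by simp
  have "Const r * Var x \<approx>\<^sub>J Var (\<Psi> (r \<cdot>\<^sub>v v))"
    using cong_sym[OF rel_gens(2)[OF Var, of r]] by (simp add: \<Psi>_smult v)
  then have "Const r * Var x \<approx>\<^sub>J subst (\<lambda>i. Var (gen i)) (\<Sum>i<s. Const (a i) * Var i)"
    using cong_trans[OF _ 1] by (simp add: subst_sum subst_mult)
  moreover have "r \<noteq> 0" by (simp add: r_def c_nonzero)
  moreover have "indets (\<Sum>i<s. Const (a i) * Var i) \<subseteq> {..<s}"
    by (intro indets_sum indets_mult) auto
  ultimately show ?case by blast
next
  case (add p p')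
  then obtain r q r' q' where r: "r \<noteq> 0" "r' \<noteq> 0" and q: "indets q \<subseteq> {..<s}" "indets q' \<subseteq> {..<s}"
    and cong: "Const r * p \<approx>\<^sub>J subst (\<lambda>i. Var (gen i)) q" "Const r' * p' \<approx>\<^sub>J subst (\<lambda>i. Var (gen i)) q'"
    by blast
  have "Const (r * r') * (p + p') = Const r' * (Const r * p) + Const r * (Const r' * p')"
    by (simp add: algebra_simps)
  also have "\<dots> \<approx>\<^sub>J subst (\<lambda>i. Var (gen i)) (Const r' * q + Const r * q')"
    unfolding subst_add subst_mult subst_Const by (intro cong_add cong_mult_left cong) simp_all
  finally show ?case using r q
    by (intro exI[of _ "r * r'"] exI[of _ "Const r' * q + Const r * q'"])
      (simp add: indets_add indets_mult)
next
  case (mult p p')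
  then obtain r q r' q' where r: "r \<noteq> 0" "r' \<noteq> 0" and q: "indets q \<subseteq> {..<s}" "indets q' \<subseteq> {..<s}"
    and cong: "Const r * p \<approx>\<^sub>J subst (\<lambda>i. Var (gen i)) q" "Const r' * p' \<approx>\<^sub>J subst (\<lambda>i. Var (gen i)) q'"
    by blast
  have "Const (r * r') * (p * p') = (Const r * p) * (Const r' * p')"
    by (simp add: algebra_simps)
  also have "\<dots> \<approx>\<^sub>J subst (\<lambda>i. Var (gen i)) (q * q')"
    unfolding subst_mult using mult(1) q
    by (intro cong_mult cong indets_mult indets_subst[of _ "{..<s}"]) (simp_all add: gen_closed)
  finally show ?case using r q
    by (intro exI[of _ "r * r'"] exI[of _ "q * q'"]) (simp add: indets_mult)
qed

text \<open>The torsion of \<open>Sym(N)\<close> is the kernel of the map to \<open>R[w]\<close>: a multiple of \<open>p\<close> is a polynomial in the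
  \<open>c\<^sub>i e\<^sub>i\<close>, and these have algebraically independent images.\<close>

lemma subst_form_of_eq_0_iff:
  assumes p: "indets p \<subseteq> carrier N"
  shows "subst form_of p = 0 \<longleftrightarrow> (\<exists>r. r \<noteq> 0 \<and> Const r * p \<in> sym_rel N)"
proof
  assume "\<exists>r. r \<noteq> 0 \<and> Const r * p \<in> sym_rel N"
  then obtain r where "r \<noteq> 0" "Const r * subst form_of p = 0"
    using subst_sym_rel[of "Const _ * p"] by (auto simp: subst_mult)
  then show "subst form_of p = 0" by simp
next
  assume 0: "subst form_of p = 0"
  obtain r q where r: "r \<noteq> 0" and q: "indets q \<subseteq> {..<s}"
    and cong: "Const r * p \<approx>\<^sub>J subst (\<lambda>i. Var (gen i)) q"
    using common_denominator[OF p] by blast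
  have "form_of (gen i) = Const (c i) * Var i" if "i < s" for i
    using that by (simp add: gen_def form_of_\<Psi> c_unit_vec linear_form_smult_unit_vec)
  then have "subst (\<lambda>i. Const (c i) * Var i) q = subst (\<lambda>i. form_of (gen i)) q"
    using q by (intro subst_cong[of _ "{..<s}"]) auto
  also have "\<dots> = subst form_of (subst (\<lambda>i. Var (gen i)) q)"
    by (simp add: subst_subst)
  also have "\<dots> = 0"
    using subst_sym_rel[OF cong] 0 by (simp add: subst_diff subst_mult)
  finally have "q = 0" using inj_subst_scaled_vars[of s c q] c_nonzero q by blast
  then show "\<exists>r. r \<noteq> 0 \<and> Const r * p \<in> sym_rel N" using r cong by auto
qed

lemma rees_embedding:
  obtains g where "g \<in> alg_hom (rees N) (mpol_alg {..<s})" "inj_on g (carrier (rees N))"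
    "g ` carrier (rees N) = subalg_gen {..<s} (linear_form s ` U)"
    "\<And>v. v \<in> U \<Longrightarrow> g (rees_in N (\<Psi> v)) = linear_form s v"
proof -
  have hom: "subst form_of \<in> alg_hom Pol (mpol_alg {..<s})"
    by (rule subst_alg_hom[OF indets_form_of])
  have ker: "rees_proj N p = rees_proj N q \<longleftrightarrow> subst form_of p = subst form_of q"
    if "p \<in> carrier Pol" "q \<in> carrier Pol" for p q
    using that subst_form_of_eq_0_iff[of "p - q"]
    by (simp add: rees_proj_eq_iff indets_diff subst_diff)
  obtain g where g: "g \<in> alg_hom (rees N) (mpol_alg {..<s})" "inj_on g (carrier (rees N))"
      "\<And>p. p \<in> carrier Pol \<Longrightarrow> g (rees_proj N p) = subst form_of p"
    using alg_hom_factor_surj[OF rees_proj_alg_hom rees_proj_surj hom ker ralgebra_mpol_alg] by blast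
  have "g ` carrier (rees N) = subst form_of ` carrier Pol"
    unfolding rees_proj_surj[symmetric] image_image using g(3) by (rule image_cong[OF refl])
  also have "\<dots> = subalg_gen {..<s} (form_of ` carrier N)"
    by (rule subst_image[OF indets_form_of])
  also have "form_of ` carrier N = linear_form s ` U"
    unfolding bij_betw_imp_surj_on[OF \<Psi>_bij, symmetric] image_image
    using form_of_\<Psi> by (rule image_cong[OF refl])
  finally have "g ` carrier (rees N) = subalg_gen {..<s} (linear_form s ` U)" .
  moreover have "g (rees_in N (\<Psi> v)) = linear_form s v" if "v \<in> U" for v
    using g(3)[of "Var (\<Psi> v)"] that by (simp add: rees_in_conv form_of_\<Psi> \<Psi>_closed)
  ultimately show thesis using that g(1,2) by blast
qed

lemma rees_in_closed: "x \<in> carrier N \<Longrightarrow> rees_in N x \<in> carrier (rees N)"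
  using alg_homD(1)[OF rees_proj_alg_hom, of "Var x"] by (simp add: rees_in_conv)

lemma ralgebra_rees: "ralgebra (rees N)"
  unfolding rees_def
  by (rule ralgebra.ralgebra_quotient[OF ralgebra_sym_alg ideal_torsion[OF ralgebra_sym_alg]])

end

section \<open>Forms in two variables\<close>

lemma UNIV_2: "(UNIV :: 2 set) = {0, 1}"
proof -
  have "card {0, 1 :: 2} = CARD(2)" by simp
  then show ?thesis by (metis card_subset_eq finite subset_UNIV)
qed

lemma x0_nonzero: "x0 \<noteq> (0 :: 'k::field polyR)"
  unfolding x0_def Var_def by (metis lookup_single_eq lookup_zero zero_neq_one)

lemma x_powers: "x0 ^ a * x1 ^ b =
    Poly_Mapping.single (Poly_Mapping.single 0 a + Poly_Mapping.single 1 b) (1::'k::field)"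
  by (simp add: single_eq_monomial_value monomial_value_add x0_def x1_def)

section \<open>The equations of a rational normal scroll\<close>

lemma det_2:
  fixes A :: "'a::comm_ring_1 mat"
  assumes A: "A \<in> carrier_mat 2 2"
  shows "det A = A $$ (0, 0) * A $$ (1, 1) - A $$ (0, 1) * A $$ (1, 0)"
proof -
  have del: "mat_delete A 0 j \<in> carrier_mat 1 1" if "j < 2" for j
    using mat_delete_carrier[OF A, of 0 j] by simp
  have "det A = (\<Sum>j<2. A $$ (0, j) * cofactor A 0 j)"
    by (rule laplace_expansion_row[OF A]) simp
  also have "\<dots> = A $$ (0, 0) * A $$ (1, 1) - A $$ (0, 1) * A $$ (1, 0)"
    using A del[of 0] del[of 1]
    by (simp add: numeral_2_eq_2 cofactor_def det_single mat_delete_def)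
  finally show ?thesis .
qed

lemma pick_doubleton:
  assumes "a < (b::nat)"
  shows "pick {a, b} 0 = a" "pick {a, b} (Suc 0) = b"
proof -
  have "{x \<in> {a, b}. x < a} = {}" "{x \<in> {a, b}. x < b} = {a}" using assms by auto
  moreover have "pick {a, b} (card {x \<in> {a, b}. x < a}) = a" "pick {a, b} (card {x \<in> {a, b}. x < b}) = b"
    by (rule pick_card_in_set, simp)+
  ultimately show "pick {a, b} 0 = a" "pick {a, b} (Suc 0) = b"
    by (simp_all only: card.empty card_1_singleton_iff One_nat_def[symmetric] is_singletonI card.insert
        finite.emptyI empty_iff not_False_eq_True)
qed

lemma minors_2_two_rows:
  fixes C :: "('a::comm_ring_1 \<times> 'a) list"
  shows "minors 2 (mat_of_cols 2 (map (\<lambda>(p, q). vec_of_list [p, q]) C)) =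
    {fst (C ! a) * snd (C ! b) - fst (C ! b) * snd (C ! a) | a b. a < b \<and> b < length C}"
proof -
  let ?A = "mat_of_cols 2 (map (\<lambda>(p, q). vec_of_list [p, q]) C)"
  have entry: "?A $$ (0, a) = fst (C ! a)" "?A $$ (Suc 0, a) = snd (C ! a)" if "a < length C" for a
    using that by (auto simp: mat_of_cols_index split: prod.split)
  have det: "det (submatrix ?A {..<2} {a, b}) = fst (C ! a) * snd (C ! b) - fst (C ! b) * snd (C ! a)"
    if ab: "a < b" "b < length C" for a b
  proof -
    have row: "{i. i < dim_row ?A \<and> i \<in> {..<2}} = {0, 1}" by auto
    have col: "{j. j < dim_col ?A \<and> j \<in> {a, b}} = {a, b}" using ab by auto
    have card: "card {i. i < dim_row ?A \<and> i \<in> {..<2}} = 2" "card {j. j < dim_col ?A \<and> j \<in> {a, b}} = 2"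
      unfolding row col using ab by simp_all
    have pick01: "pick {..<2} 0 = 0" "pick {..<2} (Suc 0) = Suc 0"
      using pick_doubleton[of 0 1] by (simp_all add: lessThan_Suc numeral_2_eq_2 insert_commute)
    have carr: "submatrix ?A {..<2} {a, b} \<in> carrier_mat 2 2"
      by (rule carrier_matI) (simp_all only: dim_submatrix card)
    have ix: "submatrix ?A {..<2} {a, b} $$ (i, j) = ?A $$ (pick {..<2} i, pick {a, b} j)"
      if "i < 2" "j < 2" for i j
      by (rule submatrix_index) (simp_all only: card that)
    have a: "a < length C" using ab by simp
    have "submatrix ?A {..<2} {a, b} $$ (0, 0) = fst (C ! a)"
      using ix[of 0 0] unfolding pick01 pick_doubleton[OF ab(1)] entry[OF a] by simp
    moreover have "submatrix ?A {..<2} {a, b} $$ (0, 1) = fst (C ! b)"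
      using ix[of 0 1] unfolding One_nat_def pick01 pick_doubleton[OF ab(1)] entry[OF ab(2)] by simp
    moreover have "submatrix ?A {..<2} {a, b} $$ (1, 0) = snd (C ! a)"
      using ix[of 1 0] unfolding One_nat_def pick01 pick_doubleton[OF ab(1)] entry[OF a] by simp
    moreover have "submatrix ?A {..<2} {a, b} $$ (1, 1) = snd (C ! b)"
      using ix[of 1 1] unfolding One_nat_def pick01 pick_doubleton[OF ab(1)] entry[OF ab(2)] by simp
    ultimately show ?thesis unfolding det_2[OF carr] by (simp only: mult.commute)
  qed
  show ?thesis
  proof (intro equalityI subsetI)
    fix x assume "x \<in> minors 2 ?A"
    then obtain I J where I: "I \<subseteq> {..<2}" "card I = 2" and J: "J \<subseteq> {..<length C}" "card J = 2"
      and x: "x = det (submatrix ?A I J)"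
      by (auto simp: minors_def)
    have "I = {..<2}" using I by (intro card_subset_eq) simp_all
    moreover obtain a b where "J = {a, b}" "a < b"
    proof -
      obtain a b where "J = {a, b}" "a \<noteq> b" using J(2) by (auto simp: card_2_iff)
      then show thesis using that[of a b] that[of b a] by (cases "a < b") (auto simp: insert_commute)
    qed
    ultimately show "x \<in> {fst (C ! a) * snd (C ! b) - fst (C ! b) * snd (C ! a) | a b. a < b \<and> b < length C}"
      using J(1) x det by blast
  next
    fix x assume "x \<in> {fst (C ! a) * snd (C ! b) - fst (C ! b) * snd (C ! a) | a b. a < b \<and> b < length C}"
    then obtain a b where ab: "a < b" "b < length C"
      and x: "x = fst (C ! a) * snd (C ! b) - fst (C ! b) * snd (C ! a)" by blast
    have "x = det (submatrix ?A {..<2} {a, b})" using det[OF ab] x by simp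
    moreover have "{a, b} \<subseteq> {..<dim_col ?A}" "card {a, b} = 2" using ab by auto
    moreover have "{..<2} \<subseteq> {..<dim_row ?A}" "card {..<2::nat} = 2" by auto
    ultimately show "x \<in> minors 2 ?A" unfolding minors_def by blast
  qed
qed

definition scroll_cols ::
  "nat \<Rightarrow> (nat \<Rightarrow> nat) \<Rightarrow> ((nat \<times> nat, 'k::field polyR) mpol \<times> (nat \<times> nat, 'k polyR) mpol) list" where
  "scroll_cols s \<sigma> = (Const x0, Const x1) # [(Var (i, j), Var (i, Suc j)). i \<leftarrow> [0..<s], j \<leftarrow> [0..<\<sigma> i]]"

lemma scroll_matrix_conv:
  "scroll_matrix s \<sigma> = mat_of_cols 2 (map (\<lambda>(p, q). vec_of_list [p, q]) (scroll_cols s \<sigma>))"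
  by (simp add: scroll_matrix_def scroll_cols_def map_concat o_def)

lemma set_scroll_cols:
  "set (scroll_cols s \<sigma>) =
    insert (Const x0, Const x1) {(Var (i, j), Var (i, Suc j)) | i j. i < s \<and> j < \<sigma> i}"
  by (auto simp: scroll_cols_def)

definition scroll_vars :: "nat \<Rightarrow> (nat \<Rightarrow> nat) \<Rightarrow> (nat \<times> nat) set" where
  "scroll_vars s \<sigma> = {(i, j). i < s \<and> j \<le> \<sigma> i}"

definition scroll_ideal :: "nat \<Rightarrow> (nat \<Rightarrow> nat) \<Rightarrow> (nat \<times> nat, 'k::field polyR) mpol set" where
  "scroll_ideal s \<sigma> = Idl\<^bsub>mpol_alg (scroll_vars s \<sigma>)\<^esub> (minors 2 (scroll_matrix s \<sigma>))"

lemma Scr_conv: "Scr s \<sigma> = quot_module (mpol_alg (scroll_vars s \<sigma>)) (scroll_ideal s \<sigma>)"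
  by (simp add: Scr_def scroll_vars_def scroll_ideal_def Let_def)

text \<open>The image of \<open>v\<^sub>i\<^sub>,\<^sub>j\<close> in \<open>R[w]\<close>.\<close>

definition scroll_param :: "(nat \<Rightarrow> nat) \<Rightarrow> nat \<times> nat \<Rightarrow> (nat, 'k::field polyR) mpol" where
  "scroll_param \<sigma> = (\<lambda>(i, j). Const (x0 ^ (\<sigma> i - j) * x1 ^ j) * Var i)"

lemma scroll_cols_indets:
  assumes "(p, q) \<in> set (scroll_cols s \<sigma>)"
  shows "indets p \<subseteq> scroll_vars s \<sigma>" "indets q \<subseteq> scroll_vars s \<sigma>"
  using assms by (auto simp: set_scroll_cols scroll_vars_def)

text \<open>In the image the second row of \<open>\<Gamma>\<close> is \<open>x\<^sub>1/x\<^sub>0\<close> times the first; hence all minors vanish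
  there.\<close>

lemma scroll_cols_param:
  assumes "(p, q) \<in> set (scroll_cols s \<sigma>)"
  shows "Const x1 * subst (scroll_param \<sigma>) p = Const x0 * subst (scroll_param \<sigma>) q"
proof -
  have "x1 * (x0 ^ (\<sigma> i - j) * x1 ^ j) = x0 * (x0 ^ (\<sigma> i - Suc j) * x1 ^ Suc j :: 'a polyR)"
    if "j < \<sigma> i" for i j
  proof -
    have "\<sigma> i - j = Suc (\<sigma> i - Suc j)" using that by simp
    then show ?thesis by (simp add: mult_ac)
  qed
  then have "Const x1 * (Const (x0 ^ (\<sigma> i - j) * x1 ^ j) * Var i) =
      Const x0 * (Const (x0 ^ (\<sigma> i - Suc j) * x1 ^ Suc j) * Var i :: (nat, 'a polyR) mpol)"
    if "j < \<sigma> i" for i j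
    using that by (simp only: mult.assoc[symmetric] Const_simps(4)[symmetric])
  then show ?thesis using assms
    by (auto simp: set_scroll_cols scroll_param_def mult.commute simp del: Const_simps Const_power)
qed

lemma minors_scroll_cases:
  assumes "g \<in> minors 2 (scroll_matrix s \<sigma> :: (nat \<times> nat, 'k::field polyR) mpol mat)"
  obtains p q p' q' where "(p, q) \<in> set (scroll_cols s \<sigma>)" "(p', q') \<in> set (scroll_cols s \<sigma>)"
    "g = p * q' - p' * q"
proof -
  let ?C = "scroll_cols s \<sigma> :: ((nat \<times> nat, 'k polyR) mpol \<times> _) list"
  obtain a b where ab: "a < b" "b < length ?C"
    and g: "g = fst (?C ! a) * snd (?C ! b) - fst (?C ! b) * snd (?C ! a)"
    using assms unfolding scroll_matrix_conv minors_2_two_rows by blast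
  have "(fst (?C ! a), snd (?C ! a)) \<in> set ?C" "(fst (?C ! b), snd (?C ! b)) \<in> set ?C"
    using ab by simp_all
  then show thesis using g by (rule that)
qed

lemma minors_scroll_indets:
  assumes "g \<in> minors 2 (scroll_matrix s \<sigma> :: (nat \<times> nat, 'k::field polyR) mpol mat)"
  shows "indets g \<subseteq> scroll_vars s \<sigma>"
  using assms
proof (rule minors_scroll_cases)
  fix p q p' q'
  assume pq: "(p, q) \<in> set (scroll_cols s \<sigma>)" "(p', q') \<in> set (scroll_cols s \<sigma>)"
    and g: "g = p * q' - p' * q"
  show ?thesis
    unfolding g by (intro indets_diff indets_mult scroll_cols_indets[OF pq(1)] scroll_cols_indets[OF pq(2)])
qed

lemma ideal_scroll_ideal: "ideal (scroll_ideal s \<sigma>) (mpol_alg (scroll_vars s \<sigma>))"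
proof -
  interpret cring "mpol_alg (scroll_vars s \<sigma>) :: ('a polyR, _) module" by (rule cring_mpol_alg)
  show ?thesis unfolding scroll_ideal_def
  proof (rule genideal_ideal, rule subsetI)
    fix g :: "(nat \<times> nat, 'a polyR) mpol"
    assume "g \<in> minors 2 (scroll_matrix s \<sigma>)"
    then show "g \<in> carrier (mpol_alg (scroll_vars s \<sigma>))"
      unfolding mpol_alg_simps mem_Collect_eq by (rule minors_scroll_indets)
  qed
qed

lemma scroll_ideal_param:
  assumes "p \<in> scroll_ideal s \<sigma>"
  shows "subst (scroll_param \<sigma>) (p :: (nat \<times> nat, 'k::field polyR) mpol) = 0"
  using assms unfolding scroll_ideal_def
proof (rule genideal_subst_eq_0[rotated 2])
  fix g assume g: "g \<in> minors 2 (scroll_matrix s \<sigma> :: (nat \<times> nat, 'k polyR) mpol mat)"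
  then show "indets g \<subseteq> scroll_vars s \<sigma>" by (rule minors_scroll_indets)
  obtain p q p' q' where pq: "(p, q) \<in> set (scroll_cols s \<sigma>)" "(p', q') \<in> set (scroll_cols s \<sigma>)"
    and g: "g = p * q' - p' * q"
    using g by (rule minors_scroll_cases)
  have "Const x0 * (P * Q') = Const x0 * (P' * Q)"
    if "Const x1 * P = Const x0 * Q" "Const x1 * P' = Const x0 * Q'" for P Q P' Q' :: "(nat, 'k polyR) mpol"
  proof -
    have "Const x0 * (P * Q') = P * (Const x0 * Q')" by (simp only: mult.left_commute)
    also have "\<dots> = P' * (Const x1 * P)" unfolding that(2)[symmetric] by (simp only: mult_ac)
    also have "\<dots> = Const x0 * (P' * Q)" unfolding that(1) by (simp only: mult.left_commute)
    finally show ?thesis .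
  qed
  then have "Const x0 * subst (scroll_param \<sigma>) g = 0"
    using scroll_cols_param[OF pq(1)] scroll_cols_param[OF pq(2)]
    unfolding g subst_diff subst_mult right_diff_distrib by simp
  then show "subst (scroll_param \<sigma>) g = 0" using x0_nonzero[where 'k='k] by simp
qed

text \<open>The form in which the minors are used: in a product, the first entry of one column and the second
  entry of another may be traded for the second entry of the one and the first of the other.\<close>

lemma scroll_exchange:
  fixes p q p' q' :: "(nat \<times> nat, 'k::field polyR) mpol"
  assumes "(p, q) \<in> set (scroll_cols s \<sigma>)" "(p', q') \<in> set (scroll_cols s \<sigma>)"
  shows "q * p' - p * q' \<in> scroll_ideal s \<sigma>"
proof -
  interpret poly_ideal "scroll_vars s \<sigma>" "scroll_ideal s \<sigma> :: (nat \<times> nat, 'k polyR) mpol set"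
    by (rule poly_ideal.intro[OF ideal_scroll_ideal])
  let ?C = "scroll_cols s \<sigma> :: ((nat \<times> nat, 'k polyR) mpol \<times> _) list"
  have gen: "fst (?C ! a) * snd (?C ! b) - fst (?C ! b) * snd (?C ! a) \<in> scroll_ideal s \<sigma>"
    if "a < b" "b < length ?C" for a b
  proof -
    have "minors 2 (scroll_matrix s \<sigma>) \<subseteq> (scroll_ideal s \<sigma> :: (nat \<times> nat, 'k polyR) mpol set)"
      unfolding scroll_ideal_def genideal_def by blast
    moreover have "fst (?C ! a) * snd (?C ! b) - fst (?C ! b) * snd (?C ! a) \<in> minors 2 (scroll_matrix s \<sigma>)"
      unfolding scroll_matrix_conv minors_2_two_rows
      by (rule CollectI, intro exI conjI) (rule refl, rule that(1), rule that(2))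
    ultimately show ?thesis by (rule subsetD)
  qed
  obtain a where a: "a < length ?C" "?C ! a = (p, q)"
    using assms(1) unfolding in_set_conv_nth by blast
  obtain b where b: "b < length ?C" "?C ! b = (p', q')"
    using assms(2) unfolding in_set_conv_nth by blast
  consider "a < b" | "a = b" | "b < a" by linarith
  then show ?thesis
  proof cases
    case 1
    have "p * q' - p' * q \<in> scroll_ideal s \<sigma>" using gen[OF 1 b(1)] unfolding a(2) b(2) by simp
    then show ?thesis using cong_sym[of "p * q'" "p' * q"] by (simp add: mult.commute)
  next
    case 2
    then have "p' = p" "q' = q" using a b by auto
    then show ?thesis using cong_refl[of 0] by (simp add: mult.commute)
  next
    case 3
    have "p' * q - p * q' \<in> scroll_ideal s \<sigma>" using gen[OF 3 a(1)] unfolding a(2) b(2) by simp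
    then show ?thesis by (simp add: mult.commute)
  qed
qed

section \<open>Monomials of a scroll\<close>

text \<open>A cell stands for a variable: \<open>(Some i, j)\<close> for \<open>v\<^sub>i\<^sub>,\<^sub>j\<close>, and \<open>(None, 0)\<close>, \<open>(None, 1)\<close> for
  \<open>x\<^sub>0\<close>, \<open>x\<^sub>1\<close>. In this way the first column of \<open>\<Gamma>\<close> is a block like the others, and monomials in
  all variables together are multisets of cells.\<close>

type_synonym cell = "nat option \<times> nat"

fun cell_cap :: "(nat \<Rightarrow> nat) \<Rightarrow> nat option \<Rightarrow> nat" where
  "cell_cap \<sigma> None = 1"
| "cell_cap \<sigma> (Some i) = \<sigma> i"

definition cells :: "nat \<Rightarrow> (nat \<Rightarrow> nat) \<Rightarrow> cell set" where
  "cells s \<sigma> = {(b, j). j \<le> cell_cap \<sigma> b \<and> (\<forall>i. b = Some i \<longrightarrow> i < s)}"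

fun cell_val :: "cell \<Rightarrow> (nat \<times> nat, 'k::field polyR) mpol" where
  "cell_val (None, j) = Const (if j = 0 then x0 else x1)"
| "cell_val (Some i, j) = Var (i, j)"

definition word_val :: "cell multiset \<Rightarrow> (nat \<times> nat, 'k::field polyR) mpol" where
  "word_val M = (\<Prod>e\<in>#M. cell_val e)"

lemma word_val_simps [simp]:
  "word_val {#} = 1" "word_val (add_mset e M) = cell_val e * word_val M"
  "word_val (M + M') = word_val M * word_val M'"
  by (simp_all add: word_val_def)

lemma cell_val_indets: "e \<in> cells s \<sigma> \<Longrightarrow> indets (cell_val e) \<subseteq> scroll_vars s \<sigma>"
  by (cases e rule: cell_val.cases) (simp_all add: cells_def scroll_vars_def)

lemma word_val_indets: "set_mset M \<subseteq> cells s \<sigma> \<Longrightarrow> indets (word_val M) \<subseteq> scroll_vars s \<sigma>"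
  by (induction M) (simp_all add: cell_val_indets indets_mult)

lemma cell_step_col:
  assumes "(b, Suc j) \<in> cells s \<sigma>"
  shows "(cell_val (b, j), cell_val (b, Suc j)) \<in> set (scroll_cols s \<sigma>)"
proof (cases b)
  case None
  then show ?thesis using assms by (simp add: cells_def set_scroll_cols)
next
  case (Some i)
  then have "i < s" "j < \<sigma> i" using assms by (simp_all add: cells_def)
  then show ?thesis unfolding Some cell_val.simps set_scroll_cols by blast
qed

text \<open>The coefficient field occurs in no parameter of a scroll; the argument \<open>ty\<close> fixes it.\<close>

locale scroll =
  fixes s :: nat and \<sigma> :: "nat \<Rightarrow> nat" and ty :: "'k::field itself"
begin

abbreviation J :: "(nat \<times> nat, 'k polyR) mpol set" where
  "J \<equiv> scroll_ideal s \<sigma>"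

abbreviation wv :: "cell multiset \<Rightarrow> (nat \<times> nat, 'k polyR) mpol" where
  "wv \<equiv> word_val"

sublocale poly_ideal "scroll_vars s \<sigma>" J
  by (rule poly_ideal.intro[OF ideal_scroll_ideal])

notation cong (infix \<open>\<approx>\<^sub>J\<close> 50)

text \<open>Each step is one exchange: as long as the other cells have positive total index, one of them can be
  lowered in favour of the distinguished cell.\<close>

lemma raise_index:
  assumes M: "set_mset M \<subseteq> cells s \<sigma>" and "n \<le> (\<Sum>e\<in>#M. snd e)" and "(b, j + n) \<in> cells s \<sigma>"
  shows "\<exists>M'. set_mset M' \<subseteq> cells s \<sigma> \<and> image_mset fst M' = image_mset fst M \<and>
    (\<Sum>e\<in>#M. snd e) = n + (\<Sum>e\<in>#M'. snd e) \<and>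
    cell_val (b, j) * wv M \<approx>\<^sub>J cell_val (b, j + n) * wv M'"
  using assms(2,3)
proof (induction n)
  case 0
  show ?case using M cong_refl by (intro exI[of _ M]) simp
next
  case (Suc n)
  have "(b, j + n) \<in> cells s \<sigma>" using Suc.prems(2) by (auto simp: cells_def)
  then obtain M' where M': "set_mset M' \<subseteq> cells s \<sigma>" "image_mset fst M' = image_mset fst M"
    "(\<Sum>e\<in>#M. snd e) = n + (\<Sum>e\<in>#M'. snd e)"
    and c: "cell_val (b, j) * wv M \<approx>\<^sub>J cell_val (b, j + n) * wv M'"
    using Suc by auto
  have "\<exists>e\<in>#M'. snd e \<noteq> 0"
  proof (rule ccontr)
    assume "\<not> (\<exists>e\<in>#M'. snd e \<noteq> 0)"
    then have "(\<Sum>e\<in>#M'. snd e) = 0" by simp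
    then show False using M'(3) Suc.prems(1) by linarith
  qed
  then obtain e where e: "e \<in># M'" "snd e \<noteq> 0" by blast
  then obtain b' l where e': "e = (b', Suc l)" by (cases e) (auto simp: gr0_conv_Suc)
  obtain K where K: "M' = add_mset (b', Suc l) K" using e(1) e' by (metis mset_add)
  have in_cells: "(b', Suc l) \<in> cells s \<sigma>" "set_mset K \<subseteq> cells s \<sigma>" using M'(1) K by auto
  then have "(b', l) \<in> cells s \<sigma>" by (auto simp: cells_def)
  have "cell_val (b, Suc (j + n)) * cell_val (b', l) \<approx>\<^sub>J cell_val (b, j + n) * cell_val (b', Suc l)"
    using Suc.prems(2) in_cells(1) by (intro scroll_exchange cell_step_col) simp_all
  then have "wv K * (cell_val (b, j + n) * cell_val (b', Suc l)) \<approx>\<^sub>J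
      wv K * (cell_val (b, Suc (j + n)) * cell_val (b', l))"
    using in_cells(2) by (intro cong_mult_left[OF cong_sym] word_val_indets)
  then have "cell_val (b, j + n) * wv M' \<approx>\<^sub>J cell_val (b, j + Suc n) * wv (add_mset (b', l) K)"
    by (simp add: K mult_ac)
  with c have "cell_val (b, j) * wv M \<approx>\<^sub>J cell_val (b, j + Suc n) * wv (add_mset (b', l) K)"
    by (rule cong_trans)
  then show ?case
    using M' K in_cells(2) \<open>(b', l) \<in> cells s \<sigma>\<close>
    by (intro exI[of _ "add_mset (b', l) K"]) simp
qed

text \<open>The moves connect all monomials with the same blocks and the same total index. Match a cell of \<open>M\<close>
  with a cell of \<open>M'\<close> in the same block, raise the smaller of their indices to the larger one at the
  expense of the remaining cells, cancel the two, and continue with the remaining cells.\<close>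

lemma word_val_cong:
  assumes "set_mset M \<subseteq> cells s \<sigma>" "set_mset M' \<subseteq> cells s \<sigma>"
    "image_mset fst M = image_mset fst M'" "(\<Sum>e\<in>#M. snd e) = (\<Sum>e\<in>#M'. snd e)"
  shows "wv M \<approx>\<^sub>J wv M'"
  using assms
proof (induction "size M" arbitrary: M M')
  case 0
  then show ?case using cong_refl by simp
next
  case (Suc k)
  obtain b j K where M: "M = add_mset (b, j) K" using Suc(2) by (metis size_eq_Suc_imp_eq_union surj_pair)
  have "image_mset fst M' = add_mset b (image_mset fst K)" using Suc(5) M by simp
  from msed_map_invR[OF this] obtain e K' where "M' = add_mset e K'" "fst e = b" by blast
  then obtain j' where M': "M' = add_mset (b, j') K'" by (cases e) simp
  have K: "set_mset K \<subseteq> cells s \<sigma>" "set_mset K' \<subseteq> cells s \<sigma>" "image_mset fst K = image_mset fst K'"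
    "j + (\<Sum>e\<in>#K. snd e) = j' + (\<Sum>e\<in>#K'. snd e)" "k = size K"
    using Suc(2-) M M' by simp_all
  have size: "size K' = k" using K(3,5) by (metis size_image_mset)
  have cells: "(b, j) \<in> cells s \<sigma>" "(b, j') \<in> cells s \<sigma>" using Suc(3,4) M M' by simp_all
  show ?case
  proof (cases "j \<le> j'")
    case True
    then have "j + (j' - j) = j'" by simp
    with raise_index[OF K(1), of "j' - j" b j] cells K(4) True
    obtain L where L: "set_mset L \<subseteq> cells s \<sigma>" "image_mset fst L = image_mset fst K"
      "(\<Sum>e\<in>#K. snd e) = j' - j + (\<Sum>e\<in>#L. snd e)"
      and c: "cell_val (b, j) * wv K \<approx>\<^sub>J cell_val (b, j') * wv L"
      by auto
    have "size L = k" using L(2) K(5) by (metis size_image_mset)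
    moreover have "(\<Sum>e\<in>#L. snd e) = (\<Sum>e\<in>#K'. snd e)" using L(3) K(4) True by simp
    ultimately have "wv L \<approx>\<^sub>J wv K'"
      using Suc(1)[of L K'] L(1,2) K(2,3) by simp
    then have "cell_val (b, j') * wv L \<approx>\<^sub>J cell_val (b, j') * wv K'"
      using cells(2) by (intro cong_mult_left cell_val_indets)
    then show ?thesis using c cong_trans unfolding M M' word_val_simps by blast
  next
    case False
    then have "j' + (j - j') = j" by simp
    with raise_index[OF K(2), of "j - j'" b j'] cells K(4) False
    obtain L where L: "set_mset L \<subseteq> cells s \<sigma>" "image_mset fst L = image_mset fst K'"
      "(\<Sum>e\<in>#K'. snd e) = j - j' + (\<Sum>e\<in>#L. snd e)"
      and c: "cell_val (b, j') * wv K' \<approx>\<^sub>J cell_val (b, j) * wv L"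
      by auto
    have "(\<Sum>e\<in>#K. snd e) = (\<Sum>e\<in>#L. snd e)" using L(3) K(4) False by simp
    then have "wv K \<approx>\<^sub>J wv L"
      using Suc(1)[of K L] L(1,2) K(1,3,5) by simp
    then have "cell_val (b, j) * wv K \<approx>\<^sub>J cell_val (b, j) * wv L"
      using cells(1) by (intro cong_mult_left cell_val_indets)
    then show ?thesis using c cong_sym cong_trans unfolding M M' word_val_simps by blast
  qed
qed

end

text \<open>The exponents in \<open>w\<close> and in \<open>x\<^sub>0, x\<^sub>1\<close> of the image of a cell, which is a monomial.\<close>

fun cell_deg :: "(nat \<Rightarrow> nat) \<Rightarrow> cell \<Rightarrow> (nat \<Rightarrow>\<^sub>0 nat) \<times> (2 \<Rightarrow>\<^sub>0 nat)" where
  "cell_deg \<sigma> (None, j) = (0, Poly_Mapping.single (if j = 0 then 0 else 1) 1)"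
| "cell_deg \<sigma> (Some i, j) = (Poly_Mapping.single i 1, Poly_Mapping.single 0 (\<sigma> i - j) + Poly_Mapping.single 1 j)"

definition word_deg :: "(nat \<Rightarrow> nat) \<Rightarrow> cell multiset \<Rightarrow> (nat \<Rightarrow>\<^sub>0 nat) \<times> (2 \<Rightarrow>\<^sub>0 nat)" where
  "word_deg \<sigma> M = (\<Sum>e\<in>#M. fst (cell_deg \<sigma> e), \<Sum>e\<in>#M. snd (cell_deg \<sigma> e))"

lemma subst_cell_val:
  "subst (scroll_param \<sigma>) (cell_val e :: (nat \<times> nat, 'k::field polyR) mpol) =
    Poly_Mapping.single (fst (cell_deg \<sigma> e)) (Poly_Mapping.single (snd (cell_deg \<sigma> e)) 1)"
proof (cases e rule: cell_val.cases)
  case (1 j)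
  then have "subst (scroll_param \<sigma>) (cell_val e :: (nat \<times> nat, 'k polyR) mpol) =
      Const (if j = 0 then x0 else x1)"
    by simp
  then show ?thesis using 1 by (simp add: Const_def x0_def x1_def Var_def)
next
  case (2 i j)
  then show ?thesis
    by (simp add: scroll_param_def x_powers del: Const_simps Const_power)
      (simp add: Const_def Var_def mult_single)
qed

lemma subst_word_val:
  "subst (scroll_param \<sigma>) (word_val M :: (nat \<times> nat, 'k::field polyR) mpol) =
    Poly_Mapping.single (fst (word_deg \<sigma> M)) (Poly_Mapping.single (snd (word_deg \<sigma> M)) 1)"
  by (induction M) (simp_all add: subst_mult subst_cell_val word_deg_def mult_single)

text \<open>The exponent of \<open>w\<^sub>i\<close> counts the cells of block \<open>i\<close>. A cell of block \<open>i\<close> contributes \<open>\<sigma>\<^sub>i\<close> to the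
  total degree in \<open>x\<^sub>0, x\<^sub>1\<close>, and a cell of the additional block contributes one; so the cells of the
  additional block are counted by what remains of that degree.\<close>

lemma image_mset_fst_eq:
  assumes M: "set_mset M \<subseteq> cells s \<sigma>" and M': "set_mset M' \<subseteq> cells s \<sigma>"
    and deg: "word_deg \<sigma> M = word_deg \<sigma> M'"
  shows "image_mset fst M = image_mset fst M'"
proof (rule multiset_eqI)
  have w: "count (image_mset fst K) (Some i) = Poly_Mapping.lookup (fst (word_deg \<sigma> K)) i" for K i
  proof (induction K)
    case (add e K)
    then show ?case
      by (cases e rule: cell_val.cases) (simp_all add: word_deg_def lookup_add lookup_single when_def)
  qed (simp add: word_deg_def)
  have x: "(\<Sum>b\<in>#image_mset fst K. cell_cap \<sigma> b) =
      Poly_Mapping.lookup (snd (word_deg \<sigma> K)) 0 + Poly_Mapping.lookup (snd (word_deg \<sigma> K)) 1"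
    if "set_mset K \<subseteq> cells s \<sigma>" for K
    using that
  proof (induction K)
    case (add e K)
    then show ?case
      by (cases e rule: cell_val.cases)
        (auto simp: word_deg_def lookup_add lookup_single when_def cells_def)
  qed (simp add: word_deg_def)
  have Some: "filter_mset (\<lambda>b. b \<noteq> None) (image_mset fst M) = filter_mset (\<lambda>b. b \<noteq> None) (image_mset fst M')"
    by (rule multiset_eqI) (use w deg in \<open>auto simp del: count_image_mset\<close>)
  have cap: "(\<Sum>b\<in>#B. cell_cap \<sigma> b) = (\<Sum>b\<in>#filter_mset (\<lambda>b. b \<noteq> None) B. cell_cap \<sigma> b) + count B None" for B
    by (induction B) auto
  have "count (image_mset fst M) None = count (image_mset fst M') None"
    using cap[of "image_mset fst M"] cap[of "image_mset fst M'"] x[OF M] x[OF M'] Some deg by simp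
  then show "count (image_mset fst M) b = count (image_mset fst M') b" for b
    using w deg by (cases b) simp_all
qed

lemma sum_snd_word:
  assumes "set_mset M \<subseteq> cells s \<sigma>"
  shows "(\<Sum>e\<in>#M. snd e) = Poly_Mapping.lookup (snd (word_deg \<sigma> M)) 1"
  using assms
proof (induction M)
  case (add e M)
  then show ?case
    by (cases e rule: cell_val.cases)
      (auto simp: word_deg_def lookup_add lookup_single when_def cells_def)
qed (simp add: word_deg_def)

text \<open>As a vector space over the field, \<open>V\<close> is spanned by the monomials in the variables and
  \<open>x\<^sub>0, x\<^sub>1\<close>.\<close>

lemma mpol_word_induct [consumes 1, case_names zero word add]:
  fixes p :: "(nat \<times> nat, 'k::field polyR) mpol"
  assumes p: "indets p \<subseteq> scroll_vars s \<sigma>" and zero: "P 0"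
    and word: "\<And>c M. set_mset M \<subseteq> cells s \<sigma> \<Longrightarrow> P (Const (Const c) * word_val M)"
    and add: "\<And>q q'. P q \<Longrightarrow> P q' \<Longrightarrow> P (q + q')"
  shows "P p"
proof (induction p rule: poly_mapping_add_induct)
  case (single t)
  then have t: "Poly_Mapping.keys t \<subseteq> scroll_vars s \<sigma>" using p by (auto simp: indets_def)
  let ?mono = "\<lambda>f. \<exists>M. set_mset M \<subseteq> cells s \<sigma> \<and> word_val M = (f :: (nat \<times> nat, 'k polyR) mpol)"
  have mono_mult: "?mono (f * g)" if "?mono f" "?mono g" for f g
    using that by (metis (no_types, lifting) set_mset_union word_val_simps(3) Un_subset_iff)
  have mono_1: "?mono 1" by (rule exI[of _ "{#}"]) simp
  have mono_power: "?mono (cell_val e ^ n)" if "e \<in> cells s \<sigma>" for e n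
  proof (induction n)
    case (Suc n)
    have "?mono (cell_val e)" using that by (intro exI[of _ "{#e#}"]) simp
    then show ?case using Suc mono_mult by simp
  qed (simp add: mono_1)
  have mono_prod: "?mono (prod f K)" if "finite K" "\<And>v. v \<in> K \<Longrightarrow> ?mono (f v)" for f :: "nat \<times> nat \<Rightarrow> _" and K
    using that by (induction K) (simp_all add: mono_1 mono_mult)
  have mono_prod2: "?mono (prod f K)" if "finite K" "\<And>v. v \<in> K \<Longrightarrow> ?mono (f v)" for f :: "2 \<Rightarrow> _" and K
    using that by (induction K) (simp_all add: mono_1 mono_mult)
  have mono_t: "?mono (Poly_Mapping.single t 1)"
    unfolding single_eq_monomial_value monomial_value_def
  proof (rule mono_prod)
    fix v assume "v \<in> Poly_Mapping.keys t"
    then obtain i j where "v = (i, j)" "(Some i, j) \<in> cells s \<sigma>"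
      using t by (cases v) (auto simp: scroll_vars_def cells_def)
    then show "?mono (Var v ^ Poly_Mapping.lookup t v)" using mono_power[of "(Some i, j)"] by simp
  qed simp
  have mono_u: "?mono (Const (Poly_Mapping.single u 1))" for u
    unfolding single_eq_monomial_value monomial_value_def Const_prod
  proof (rule mono_prod2)
    fix v assume "v \<in> Poly_Mapping.keys u"
    have "v = 0 \<or> v = 1" using UNIV_2 by blast
    then show "?mono (Const (Var v ^ Poly_Mapping.lookup u v))"
      using mono_power[of "(None, 0)"] mono_power[of "(None, 1)"]
      by (auto simp: cells_def x0_def x1_def)
  qed simp
  have "P (Poly_Mapping.single t r)" for r
  proof (induction r rule: poly_mapping_add_induct)
    case (single u)
    define c where "c = Poly_Mapping.lookup r u"
    obtain M where M: "set_mset M \<subseteq> cells s \<sigma>"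
      "word_val M = Const (Poly_Mapping.single u 1) * (Poly_Mapping.single t 1 :: (nat \<times> nat, 'k polyR) mpol)"
      using mono_mult[OF mono_u[of u] mono_t] by blast
    have "Poly_Mapping.single t (Poly_Mapping.single u c) = Const (Const c) * (word_val M :: (nat \<times> nat, 'k polyR) mpol)"
      unfolding M(2) by (simp add: Const_def mult_single)
    then show ?case using word[OF M(1), of c] by (simp add: c_def)
  next
    case (add q q')
    then show ?case using assms(4) by (simp add: single_add)
  qed (simp add: zero)
  then show ?case .
qed (use assms in auto)

context scroll
begin

text \<open>One chosen monomial of \<open>V\<close> over each monomial of \<open>R[w]\<close> in the image; the choice has no meaning
  for the other monomials. Its linear extension \<open>param_section\<close> inverts the parametrization modulo
  the minors.\<close>

definition representative :: "(nat \<Rightarrow>\<^sub>0 nat) \<Rightarrow> (2 \<Rightarrow>\<^sub>0 nat) \<Rightarrow> (nat \<times> nat, 'k polyR) mpol" where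
  "representative \<alpha> u = word_val (SOME M. set_mset M \<subseteq> cells s \<sigma> \<and> word_deg \<sigma> M = (\<alpha>, u))"

definition coeff_section :: "(nat \<Rightarrow>\<^sub>0 nat) \<Rightarrow> 'k polyR \<Rightarrow> (nat \<times> nat, 'k polyR) mpol" where
  "coeff_section \<alpha> r =
     (\<Sum>u\<in>Poly_Mapping.keys r. Const (Const (Poly_Mapping.lookup r u)) * representative \<alpha> u)"

definition param_section :: "(nat, 'k polyR) mpol \<Rightarrow> (nat \<times> nat, 'k polyR) mpol" where
  "param_section q = (\<Sum>\<alpha>\<in>Poly_Mapping.keys q. coeff_section \<alpha> (Poly_Mapping.lookup q \<alpha>))"

lemma coeff_section_0 [simp]: "coeff_section \<alpha> 0 = 0"
  by (simp add: coeff_section_def)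

lemma coeff_section_add: "coeff_section \<alpha> (r + r') = coeff_section \<alpha> r + coeff_section \<alpha> r'"
  unfolding coeff_section_def by (rule setsum_keys_plus_distrib) (simp_all add: distrib_right)

lemma param_section_0 [simp]: "param_section 0 = 0"
  by (simp add: param_section_def)

lemma param_section_add: "param_section (q + q') = param_section q + param_section q'"
  unfolding param_section_def by (rule setsum_keys_plus_distrib) (simp_all add: coeff_section_add)

lemma param_section_single:
  "param_section (Poly_Mapping.single \<alpha> (Poly_Mapping.single u c)) = Const (Const c) * representative \<alpha> u"
proof -
  have "param_section (Poly_Mapping.single \<alpha> r) = coeff_section \<alpha> r" for r
    by (cases "r = 0") (simp_all add: param_section_def)
  moreover have "coeff_section \<alpha> (Poly_Mapping.single u c) = Const (Const c) * representative \<alpha> u"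
    by (cases "c = 0") (simp_all add: coeff_section_def)
  ultimately show ?thesis by simp
qed

lemma cong_param_section:
  assumes "indets p \<subseteq> scroll_vars s \<sigma>"
  shows "p \<approx>\<^sub>J param_section (subst (scroll_param \<sigma>) p)"
  using assms
proof (induction rule: mpol_word_induct)
  case zero
  show ?case using cong_refl[of 0] by simp
next
  case (word c M)
  obtain \<alpha> u where deg: "word_deg \<sigma> M = (\<alpha>, u)" by (rule prod.exhaust)
  define M' where "M' = (SOME M. set_mset M \<subseteq> cells s \<sigma> \<and> word_deg \<sigma> M = (\<alpha>, u))"
  have M': "set_mset M' \<subseteq> cells s \<sigma> \<and> word_deg \<sigma> M' = (\<alpha>, u)"
    unfolding M'_def by (rule someI[of _ M]) (use word deg in simp)
  have "wv M \<approx>\<^sub>J wv M'"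
    using M' word deg image_mset_fst_eq[OF word, of M'] sum_snd_word[OF word] sum_snd_word[of M' s \<sigma>]
    by (intro word_val_cong) simp_all
  then have "Const (Const c) * wv M \<approx>\<^sub>J Const (Const c) * representative \<alpha> u"
    unfolding representative_def M'_def[symmetric] by (intro cong_mult_left) simp_all
  moreover have "subst (scroll_param \<sigma>) (Const (Const c) * wv M) =
      Poly_Mapping.single \<alpha> (Poly_Mapping.single u c)"
    unfolding subst_mult subst_Const subst_word_val deg by (simp add: Const_def mult_single)
  ultimately show ?case by (simp only: param_section_single)
next
  case (add q q')
  then show ?case unfolding subst_add param_section_add by (intro cong_add)
qed

text \<open>If the image of \<open>p\<close> vanishes then so does its image under the linear section, to which \<open>p\<close> is
  congruent.\<close>

theorem scroll_ideal_eq_kernel: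
  assumes "indets p \<subseteq> scroll_vars s \<sigma>"
  shows "p \<in> J \<longleftrightarrow> subst (scroll_param \<sigma>) p = 0"
  using cong_param_section[OF assms] scroll_ideal_param by auto

lemma indets_scroll_param: "v \<in> scroll_vars s \<sigma> \<Longrightarrow> indets (scroll_param \<sigma> v :: (nat, 'k polyR) mpol) \<subseteq> {..<s}"
  by (cases v) (simp add: scroll_param_def scroll_vars_def indets_mult del: Const_simps Const_power)

lemma ralgebra_Scr: "ralgebra (Scr s \<sigma> :: ('k polyR, _) module)"
  unfolding Scr_conv by (rule ralgebra.ralgebra_quotient[OF ralgebra_mpol_alg ideal_scroll_ideal])

lemma Scr_embedding:
  obtains g :: "(nat \<times> nat, 'k polyR) mpol set \<Rightarrow> (nat, 'k polyR) mpol"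
  where "g \<in> alg_hom (Scr s \<sigma>) (mpol_alg {..<s})" "inj_on g (carrier (Scr s \<sigma>))"
    "g ` carrier (Scr s \<sigma>) = subalg_gen {..<s} (scroll_param \<sigma> ` scroll_vars s \<sigma>)"
proof -
  let ?V = "mpol_alg (scroll_vars s \<sigma>) :: ('k polyR, (nat \<times> nat, 'k polyR) mpol) module"
  let ?\<pi> = "\<lambda>p. J +>\<^bsub>?V\<^esub> p"
  interpret V: ralgebra ?V by (rule ralgebra_mpol_alg)
  have \<pi>: "?\<pi> \<in> alg_hom ?V (Scr s \<sigma>)" "?\<pi> ` carrier ?V = carrier (Scr s \<sigma>)"
    unfolding Scr_conv by (rule V.proj_alg_hom V.proj_surj, rule ideal_scroll_ideal)+
  have \<epsilon>: "subst (scroll_param \<sigma>) \<in> alg_hom ?V (mpol_alg {..<s})"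
    by (rule subst_alg_hom[OF indets_scroll_param])
  have ker: "?\<pi> p = ?\<pi> q \<longleftrightarrow> subst (scroll_param \<sigma>) p = subst (scroll_param \<sigma>) q"
    if pq: "p \<in> carrier ?V" "q \<in> carrier ?V" for p q
  proof -
    have "?\<pi> p = ?\<pi> q \<longleftrightarrow> p - q \<in> J"
      using V.quotient_eq_iff_same_a_r_cos[OF ideal_scroll_ideal pq] pq by simp
    also have "\<dots> \<longleftrightarrow> subst (scroll_param \<sigma>) (p - q) = 0"
      using pq by (intro scroll_ideal_eq_kernel indets_diff) simp_all
    finally show ?thesis by (simp add: subst_diff)
  qed
  obtain g where g: "g \<in> alg_hom (Scr s \<sigma>) (mpol_alg {..<s})" "inj_on g (carrier (Scr s \<sigma>))"
      "\<And>p. p \<in> carrier ?V \<Longrightarrow> g (?\<pi> p) = subst (scroll_param \<sigma>) p"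
    using alg_hom_factor_surj[OF \<pi> \<epsilon> ker ralgebra_mpol_alg] by blast
  have "g ` carrier (Scr s \<sigma>) = subst (scroll_param \<sigma>) ` carrier ?V"
    unfolding \<pi>(2)[symmetric] image_image using g(3) by (rule image_cong[OF refl])
  also have "\<dots> = subalg_gen {..<s} (scroll_param \<sigma> ` scroll_vars s \<sigma>)"
    by (rule subst_image[OF indets_scroll_param])
  finally show thesis using that g(1,2) by blast
qed

end

section \<open>Truncations of graded free modules\<close>

lemma degree_2: "(\<Sum>v\<in>Poly_Mapping.keys t. Poly_Mapping.lookup t v) =
    Poly_Mapping.lookup t 0 + Poly_Mapping.lookup t (1::2)"
proof -
  have "(\<Sum>v\<in>Poly_Mapping.keys t. Poly_Mapping.lookup t v) = (\<Sum>v\<in>UNIV. Poly_Mapping.lookup t v)"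
    by (rule sum.mono_neutral_left) (auto simp: in_keys_iff)
  then show ?thesis unfolding UNIV_2 by simp
qed

text \<open>The \<open>a\<close>th power of the ideal \<open>(x\<^sub>0, x\<^sub>1)\<close>.\<close>

definition order_ge :: "nat \<Rightarrow> 'k::field polyR set" where
  "order_ge a = {p. \<forall>t\<in>Poly_Mapping.keys p. a \<le> Poly_Mapping.lookup t 0 + Poly_Mapping.lookup t 1}"

lemma order_ge_0 [simp]: "0 \<in> order_ge a"
  by (simp add: order_ge_def)

lemma order_ge_add: "p \<in> order_ge a \<Longrightarrow> q \<in> order_ge a \<Longrightarrow> p + q \<in> order_ge a"
  unfolding order_ge_def using keys_add[of p q] by blast

lemma order_ge_uminus: "p \<in> order_ge a \<Longrightarrow> - p \<in> order_ge a"
  by (simp add: order_ge_def)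

lemma order_ge_mult:
  assumes "p \<in> order_ge a"
  shows "r * p \<in> order_ge a"
  unfolding order_ge_def
proof safe
  fix t assume "t \<in> Poly_Mapping.keys (r * p)"
  then obtain u v where "t = u + v" "v \<in> Poly_Mapping.keys p" using keys_mult[of r p] by blast
  then show "a \<le> Poly_Mapping.lookup t 0 + Poly_Mapping.lookup t 1"
    using assms by (auto simp: order_ge_def lookup_add)
qed

lemma forms_order_ge: "0 \<le> j \<Longrightarrow> forms (int a + j) \<subseteq> order_ge a"
  unfolding forms_def order_ge_def degree_2 by fastforce

lemma single_forms: "Poly_Mapping.single t c \<in> forms (int (Poly_Mapping.lookup t 0 + Poly_Mapping.lookup t 1))"
  unfolding forms_def degree_2 by simp

lemma x_power_order_ge: "j \<le> a \<Longrightarrow> x0 ^ (a - j) * x1 ^ j \<in> order_ge a"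
  unfolding x_powers order_ge_def by (simp add: lookup_add lookup_single)

text \<open>A monomial of degree at least \<open>a\<close> is divisible by one of degree \<open>a\<close>; the divisor takes as many factors
  \<open>x\<^sub>1\<close> as there are.\<close>

lemma single_factor:
  assumes "a \<le> Poly_Mapping.lookup t 0 + Poly_Mapping.lookup t (1::2)"
  obtains j r where "j \<le> a" "Poly_Mapping.single t (c::'k::field) = r * (x0 ^ (a - j) * x1 ^ j)"
proof -
  \<comment> \<open>This leaves \<open>a - j\<close> factors \<open>x\<^sub>0\<close>, which are present because the degree is at least \<open>a\<close>.\<close>
  define j where "j = min a (Poly_Mapping.lookup t 1)"
  define u where "u = Poly_Mapping.single 0 (Poly_Mapping.lookup t 0 - (a - j)) +
      Poly_Mapping.single (1::2) (Poly_Mapping.lookup t 1 - j)"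
  have "t = u + (Poly_Mapping.single 0 (a - j) + Poly_Mapping.single 1 j)"
  proof (rule poly_mapping_eqI)
    fix v :: 2
    have "v = 0 \<or> v = 1" using UNIV_2 by blast
    then show "Poly_Mapping.lookup t v = Poly_Mapping.lookup
        (u + (Poly_Mapping.single 0 (a - j) + Poly_Mapping.single 1 j)) v"
      using assms by (auto simp: u_def j_def lookup_add lookup_single when_def)
  qed
  then have "Poly_Mapping.single t c = Poly_Mapping.single u c * (x0 ^ (a - j) * x1 ^ j)"
    unfolding x_powers mult_single by simp
  moreover have "j \<le> a" by (simp add: j_def)
  ultimately show thesis using that by blast
qed

definition order_ge_vec :: "nat \<Rightarrow> (nat \<Rightarrow> nat) \<Rightarrow> 'k::field polyR vec set" where
  "order_ge_vec s \<sigma> = {v \<in> carrier_vec s. \<forall>i<s. v $ i \<in> order_ge (\<sigma> i)}"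

text \<open>The monomials of degree \<open>\<sigma>\<^sub>i\<close> generate the \<open>\<sigma>\<^sub>i\<close>th power of \<open>(x\<^sub>0, x\<^sub>1)\<close>.\<close>

lemma subalg_gen_linear_forms:
  "subalg_gen {..<s} (linear_form s ` order_ge_vec s \<sigma>) =
    subalg_gen {..<s} (scroll_param \<sigma> ` scroll_vars s \<sigma> :: (nat, 'k::field polyR) mpol set)"
proof (intro equalityI subalg_gen_mono)
  let ?S = "subalg_gen {..<s} (scroll_param \<sigma> ` scroll_vars s \<sigma> :: (nat, 'k polyR) mpol set)"
  have *: "Const p * Var i \<in> ?S" if i: "i < s" and p: "p \<in> order_ge (\<sigma> i)" for p i
  proof (induction p rule: poly_mapping_add_induct)
    case zero
    show ?case by (simp add: subalg_gen_0)
  next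
    case (single t)
    then have "\<sigma> i \<le> Poly_Mapping.lookup t 0 + Poly_Mapping.lookup t 1" using p by (auto simp: order_ge_def)
    then obtain j r where j: "j \<le> \<sigma> i"
      and r: "Poly_Mapping.single t (Poly_Mapping.lookup p t) = r * (x0 ^ (\<sigma> i - j) * x1 ^ j)"
      by (rule single_factor)
    have "scroll_param \<sigma> (i, j) \<in> ?S"
      using i j by (intro subalg_gen_incl imageI) (simp add: scroll_vars_def)
    then have "Const r * scroll_param \<sigma> (i, j) \<in> ?S" by (intro subalg_gen_mult subalg_gen_Const)
    then show ?case unfolding r by (simp add: scroll_param_def mult.assoc)
  next
    case (add q q')
    then show ?case by (simp add: distrib_right subalg_gen_add)
  qed
  show "linear_form s ` order_ge_vec s \<sigma> \<subseteq> ?S"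
    unfolding linear_form_def by (auto simp: order_ge_vec_def intro!: subalg_gen_sum *)
  show "scroll_param \<sigma> ` scroll_vars s \<sigma> \<subseteq>
      subalg_gen {..<s} (linear_form s ` (order_ge_vec s \<sigma> :: 'k polyR vec set))"
  proof safe
    fix i j assume "(i, j) \<in> scroll_vars s \<sigma>"
    then have ij: "i < s" "j \<le> \<sigma> i" by (simp_all add: scroll_vars_def)
    let ?v = "(x0 ^ (\<sigma> i - j) * x1 ^ j) \<cdot>\<^sub>v unit_vec s i :: 'k polyR vec"
    have "?v \<in> order_ge_vec s \<sigma>"
      using ij x_power_order_ge[OF ij(2)] by (auto simp: order_ge_vec_def unit_vec_def)
    moreover have "scroll_param \<sigma> (i, j) = linear_form s ?v"
      by (subst linear_form_smult_unit_vec[OF ij(1)]) (simp add: scroll_param_def)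
    ultimately show "scroll_param \<sigma> (i, j) \<in> subalg_gen {..<s} (linear_form s ` (order_ge_vec s \<sigma> :: 'k polyR vec set))"
      by (simp add: subalg_gen_incl)
  qed
qed

lemma subalg_gen_all_linear_forms:
  "subalg_gen {..<s} (linear_form s ` carrier_vec s) =
    carrier (mpol_alg {..<s} :: ('r::comm_ring_1, (nat, 'r) mpol) module)"
proof
  interpret cring "mpol_alg {..<s} :: ('r, (nat, 'r) mpol) module" by (rule cring_mpol_alg)
  show "subalg_gen {..<s} (linear_form s ` carrier_vec s) \<subseteq> carrier (mpol_alg {..<s} :: ('r, (nat, 'r) mpol) module)"
    unfolding subalg_gen_def by (rule generate_ring_incl) (auto dest: subsetD[OF indets_linear_form])
  have "carrier (mpol_alg {..<s} :: ('r, (nat, 'r) mpol) module) = subst Var ` carrier (mpol_alg {..<s})"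
    by (simp add: subst_Var_id)
  also have "\<dots> = subalg_gen {..<s} (Var ` {..<s})" by (rule subst_image) simp
  also have "\<dots> \<subseteq> subalg_gen {..<s} (linear_form s ` carrier_vec s)"
  proof (rule subalg_gen_mono, safe)
    fix i assume "i < s"
    then have "(Var i :: (nat, 'r) mpol) = linear_form s (1 \<cdot>\<^sub>v unit_vec s i)"
      using linear_form_smult_unit_vec[of i s "1::'r"] by simp
    then show "(Var i :: (nat, 'r) mpol) \<in> subalg_gen {..<s} (linear_form s ` carrier_vec s)"
      by (simp add: subalg_gen_incl)
  qed
  finally show "carrier (mpol_alg {..<s} :: ('r, (nat, 'r) mpol) module) \<subseteq>
    subalg_gen {..<s} (linear_form s ` carrier_vec s)" .
qed

text \<open>The condition on \<open>\<Psi> 0\<close> relates the zero field of the record \<open>F\<close>, which \<^const>\<open>generate\<close> refers to,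
  to the addition of \<open>F\<close>.\<close>

locale graded_free_module =
  fixes F :: "('k::field polyR, 'm) module" and gr :: "int \<Rightarrow> 'm set"
    and s :: nat and \<sigma> :: "nat \<Rightarrow> nat" and \<Psi> :: "'k polyR vec \<Rightarrow> 'm"
  assumes graded: "\<Psi> \<in> graded_iso (module_vec TYPE('k polyR) s) (free_grading s (\<lambda>i. int (\<sigma> i))) F gr"
    and zero: "\<Psi> (0\<^sub>v s) = \<zero>\<^bsub>F\<^esub>"
begin

lemma bij: "bij_betw \<Psi> (carrier_vec s) (carrier F)"
  using graded by (simp add: graded_iso_def iso_def module_vec_simps)

lemma add: "v \<in> carrier_vec s \<Longrightarrow> w \<in> carrier_vec s \<Longrightarrow> \<Psi> (v + w) = \<Psi> v \<oplus>\<^bsub>F\<^esub> \<Psi> w"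
  using graded by (auto simp: graded_iso_def iso_def hom_def module_vec_simps)

lemma smult: "v \<in> carrier_vec s \<Longrightarrow> \<Psi> (r \<cdot>\<^sub>v v) = r \<odot>\<^bsub>F\<^esub> \<Psi> v"
  using graded by (simp add: graded_iso_def module_vec_simps)

lemma grading: "gr j = \<Psi> ` free_grading s (\<lambda>i. int (\<sigma> i)) j"
  using graded by (simp add: graded_iso_def)

lemma closed: "v \<in> carrier_vec s \<Longrightarrow> \<Psi> v \<in> carrier F"
  using bij by (rule bij_betwE[THEN bspec])

lemma inverse:
  assumes v: "v \<in> carrier_vec s"
  shows "inv\<^bsub>add_monoid F\<^esub> (\<Psi> v) = \<Psi> (- v)"
proof -
  have *: "\<Psi> v \<oplus>\<^bsub>F\<^esub> \<Psi> (- v) = \<zero>\<^bsub>F\<^esub>" "\<Psi> (- v) \<oplus>\<^bsub>F\<^esub> \<Psi> v = \<zero>\<^bsub>F\<^esub>"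
    using v zero by (simp_all flip: add)
  have "y = \<Psi> (- v)" if y: "y \<in> carrier F" "\<Psi> v \<oplus>\<^bsub>F\<^esub> y = \<zero>\<^bsub>F\<^esub>" for y
  proof -
    obtain w where w: "w \<in> carrier_vec s" "y = \<Psi> w"
      using y(1) bij unfolding bij_betw_def by blast
    then have "\<Psi> (v + w) = \<Psi> (0\<^sub>v s)" using v y(2) zero by (simp add: add)
    then have "v + w = 0\<^sub>v s"
      using bij v w by (intro inj_onD[of \<Psi> "carrier_vec s"]) (auto simp: bij_betw_def)
    then have "w = - v" using v w by (intro eq_vecI) (auto simp: vec_eq_iff eq_neg_iff_add_eq_0 add.commute)
    then show ?thesis using w by simp
  qed
  then show ?thesis
    unfolding m_inv_def using v * closed by (intro the_equality) auto
qed

lemma smult_unit_vec_in_generate: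
  assumes i: "i < s" and p: "p \<in> order_ge (\<sigma> i)"
  shows "\<Psi> (p \<cdot>\<^sub>v unit_vec s i) \<in> generate (add_monoid F) (\<Union>j\<in>{0..}. gr j)"
proof (induction p rule: poly_mapping_add_induct)
  case zero
  have "0 \<cdot>\<^sub>v unit_vec s i = (0\<^sub>v s :: 'k polyR vec)" by (intro eq_vecI) auto
  then show ?case using graded_free_module.zero[OF graded_free_module_axioms] generate.one[of "add_monoid F"] by simp
next
  case (single t)
  let ?j = "int (Poly_Mapping.lookup t 0 + Poly_Mapping.lookup t 1) - int (\<sigma> i)"
  have "0 \<le> ?j" using p single by (auto simp: order_ge_def)
  moreover have "Poly_Mapping.single t (Poly_Mapping.lookup p t) \<cdot>\<^sub>v unit_vec s i \<in>
      free_grading s (\<lambda>i. int (\<sigma> i)) ?j"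
    using single_forms[of t "Poly_Mapping.lookup p t"]
    by (auto simp: free_grading_def unit_vec_def forms_def)
  ultimately show ?case unfolding grading by (intro generate.incl) auto
next
  case (add q q')
  have "(q + q') \<cdot>\<^sub>v unit_vec s i = q \<cdot>\<^sub>v unit_vec s i + q' \<cdot>\<^sub>v unit_vec s i"
    by (rule add_smult_distrib_vec)
  then show ?case
    using generate.eng[OF add] by (simp add: graded_free_module.add[OF graded_free_module_axioms])
qed

text \<open>Every vector with entries in the powers of \<open>(x\<^sub>0, x\<^sub>1)\<close> is the sum of terms \<open>c x\<^sup>t e\<^sub>i\<close>, which
  are homogeneous of degree \<open>|t| - \<sigma>\<^sub>i \<ge> 0\<close>. The converse holds because these vectors form a group.\<close>

lemma trunc_carrier: "carrier (trunc_nonneg F gr) = \<Psi> ` order_ge_vec s \<sigma>"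
proof (intro equalityI subsetI)
  fix x assume "x \<in> carrier (trunc_nonneg F gr)"
  then have "x \<in> generate (add_monoid F) (\<Union>j\<in>{0..}. gr j)" by (simp add: trunc_nonneg_def)
  then show "x \<in> \<Psi> ` order_ge_vec s \<sigma>"
  proof (induction rule: generate.induct)
    case one
    show ?case using zero by (auto simp: order_ge_vec_def intro!: image_eqI[of _ _ "0\<^sub>v s"])
  next
    case (incl h)
    then obtain j v where "0 \<le> j" "v \<in> free_grading s (\<lambda>i. int (\<sigma> i)) j" "h = \<Psi> v"
      unfolding grading by auto
    then show ?case using forms_order_ge[of j] by (auto simp: order_ge_vec_def free_grading_def)
  next
    case (inv h)
    then obtain j v where j: "0 \<le> j" and v: "v \<in> free_grading s (\<lambda>i. int (\<sigma> i)) j" and h: "h = \<Psi> v"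
      unfolding grading by auto
    have "(- v) $ i \<in> order_ge (\<sigma> i)" if "i < s" for i
    proof -
      have "v $ i \<in> order_ge (\<sigma> i)"
        using v that by (intro subsetD[OF forms_order_ge[OF j]]) (simp add: free_grading_def)
      moreover have "(- v) $ i = - (v $ i)" using v that by (auto simp: free_grading_def)
      ultimately show ?thesis by (simp add: order_ge_uminus)
    qed
    then have "- v \<in> order_ge_vec s \<sigma>" using v by (simp add: order_ge_vec_def free_grading_def)
    moreover have "inv\<^bsub>add_monoid F\<^esub> h = \<Psi> (- v)" using v h by (simp add: inverse free_grading_def)
    ultimately show ?case by blast
  next
    case (eng h h')
    then obtain v w where "v \<in> order_ge_vec s \<sigma>" "w \<in> order_ge_vec s \<sigma>" "h = \<Psi> v" "h' = \<Psi> w" by blast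
    then show ?case
      by (auto simp: order_ge_vec_def order_ge_add add intro!: image_eqI[of _ _ "v + w"])
  qed
next
  fix x assume "x \<in> \<Psi> ` order_ge_vec s \<sigma>"
  then obtain v :: "'k polyR vec" where v: "v \<in> carrier_vec s" "\<And>i. i < s \<Longrightarrow> v $ i \<in> order_ge (\<sigma> i)" "x = \<Psi> v"
    by (auto simp: order_ge_vec_def)
  have "\<Psi> (vec s (\<lambda>i. if i < k then v $ i else 0)) \<in> carrier (trunc_nonneg F gr)" if "k \<le> s" for k
    using that
  proof (induction k)
    case 0
    have "vec s (\<lambda>i. if i < 0 then v $ i else 0) = 0\<^sub>v s" by (intro eq_vecI) auto
    then show ?case using zero generate.one[of "add_monoid F"] by (simp add: trunc_nonneg_def)
  next
    case (Suc k)
    have e: "vec s (\<lambda>i. if i < Suc k then v $ i else 0) =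
        vec s (\<lambda>i. if i < k then v $ i else 0) + (v $ k) \<cdot>\<^sub>v unit_vec s k"
      by (intro eq_vecI) (auto simp: unit_vec_def less_Suc_eq)
    have "\<Psi> ((v $ k) \<cdot>\<^sub>v unit_vec s k) \<in> carrier (trunc_nonneg F gr)"
      using smult_unit_vec_in_generate[of k "v $ k"] v(2) Suc.prems by (simp add: trunc_nonneg_def)
    then show ?case
      using Suc generate.eng[of "\<Psi> (vec s (\<lambda>i. if i < k then v $ i else 0))" "add_monoid F" _
          "\<Psi> ((v $ k) \<cdot>\<^sub>v unit_vec s k)"]
      unfolding e by (simp add: trunc_nonneg_def add)
  qed
  from this[of s] have "\<Psi> (vec s (\<lambda>i. if i < s then v $ i else 0)) \<in> carrier (trunc_nonneg F gr)" by simp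
  moreover have "vec s (\<lambda>i. if i < s then v $ i else 0) = v" using v(1) by (intro eq_vecI) auto
  ultimately show "x \<in> carrier (trunc_nonneg F gr)" using v(3) by simp
qed

sublocale whole: full_rank_module F s "carrier_vec s" \<Psi> "\<lambda>_. 1"
  using bij add smult by unfold_locales auto

sublocale trunc: full_rank_module "trunc_nonneg F gr" s "order_ge_vec s \<sigma>" \<Psi> "\<lambda>i. x0 ^ \<sigma> i"
proof
  have trunc: "x \<oplus>\<^bsub>trunc_nonneg F gr\<^esub> y = x \<oplus>\<^bsub>F\<^esub> y" "r \<odot>\<^bsub>trunc_nonneg F gr\<^esub> x = r \<odot>\<^bsub>F\<^esub> x" for x y r
    by (simp_all add: trunc_nonneg_def)
  show U: "order_ge_vec s \<sigma> \<subseteq> carrier_vec s" by (auto simp: order_ge_vec_def)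
  show "v + w \<in> order_ge_vec s \<sigma>" "\<Psi> (v + w) = \<Psi> v \<oplus>\<^bsub>trunc_nonneg F gr\<^esub> \<Psi> w"
    if "v \<in> order_ge_vec s \<sigma>" "w \<in> order_ge_vec s \<sigma>" for v w
    using that unfolding trunc by (auto simp: order_ge_vec_def order_ge_add add)
  show "r \<cdot>\<^sub>v v \<in> order_ge_vec s \<sigma>" "\<Psi> (r \<cdot>\<^sub>v v) = r \<odot>\<^bsub>trunc_nonneg F gr\<^esub> \<Psi> v"
    if "v \<in> order_ge_vec s \<sigma>" for r v
    using that unfolding trunc by (auto simp: order_ge_vec_def order_ge_mult smult)
  show "0\<^sub>v s \<in> order_ge_vec s \<sigma>" by (simp add: order_ge_vec_def)
  show "x0 ^ \<sigma> i \<noteq> (0 :: 'k polyR)" for i by (simp add: x0_nonzero)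
  show "x0 ^ \<sigma> i \<cdot>\<^sub>v unit_vec s i \<in> order_ge_vec s \<sigma>" if "i < s" for i
    using that x_power_order_ge[of 0 "\<sigma> i"] by (auto simp: order_ge_vec_def unit_vec_def)
  show "bij_betw \<Psi> (order_ge_vec s \<sigma>) (carrier (trunc_nonneg F gr))"
    unfolding trunc_carrier using bij U by (auto simp: bij_betw_def intro: inj_on_subset)
qed

end

section \<open>The Rees algebra of a truncation\<close>

context graded_free_module
begin

text \<open>The Rees algebras of the module and of its truncation both embed into \<open>R[w]\<close>, the former onto
  it. The two maps are the lifts of the identity of \<open>R[w]\<close> and of the embedding of the latter; all claims
  are checked after embedding.\<close>

theorem rees_trunc_in_rees:
  "\<exists>\<iota> \<theta>. \<iota> \<in> alg_hom (rees (trunc_nonneg F gr)) (rees F) \<and>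
    (\<forall>x\<in>carrier (trunc_nonneg F gr). \<iota> (rees_in (trunc_nonneg F gr) x) = rees_in F x) \<and>
    inj_on \<iota> (carrier (rees (trunc_nonneg F gr))) \<and>
    \<theta> \<in> alg_iso (mpol_alg {..<s}) (rees F) \<and>
    (\<forall>i<s. \<theta> (Var i) = rees_in F (\<Psi> (unit_vec s i))) \<and>
    \<iota> ` carrier (rees (trunc_nonneg F gr)) = \<theta> ` subalg_gen {..<s} (scroll_param \<sigma> ` scroll_vars s \<sigma>)"
proof -
  let ?M = "trunc_nonneg F gr"
  obtain gF where gF: "gF \<in> alg_hom (rees F) (mpol_alg {..<s})" "inj_on gF (carrier (rees F))"
    "gF ` carrier (rees F) = subalg_gen {..<s} (linear_form s ` carrier_vec s)"
    "\<And>v. v \<in> carrier_vec s \<Longrightarrow> gF (rees_in F (\<Psi> v)) = linear_form s v"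
    using whole.rees_embedding by blast
  obtain gM where gM: "gM \<in> alg_hom (rees ?M) (mpol_alg {..<s})" "inj_on gM (carrier (rees ?M))"
    "gM ` carrier (rees ?M) = subalg_gen {..<s} (linear_form s ` order_ge_vec s \<sigma>)"
    "\<And>v. v \<in> order_ge_vec s \<sigma> \<Longrightarrow> gM (rees_in ?M (\<Psi> v)) = linear_form s v"
    using trunc.rees_embedding by blast
  let ?P = "mpol_alg {..<s} :: ('k polyR, (nat, 'k polyR) mpol) module"
  have surj: "gF ` carrier (rees F) = carrier ?P"
    unfolding gF(3) by (rule subalg_gen_all_linear_forms)
  have id: "(\<lambda>p. p) \<in> alg_hom ?P ?P" by (rule alg_homI) simp_all
  obtain \<theta> where \<theta>: "\<theta> \<in> alg_iso ?P (rees F)" "\<And>p. p \<in> carrier ?P \<Longrightarrow> gF (\<theta> p) = p"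
    using alg_iso_lift_inj[OF id _ gF(1,2) _ ralgebra_mpol_alg whole.ralgebra_rees] surj by auto
  then have \<theta>_hom: "\<theta> \<in> alg_hom ?P (rees F)" by (simp add: alg_iso_def)
  have "gM ` carrier (rees ?M) \<subseteq> gF ` carrier (rees F)"
    unfolding surj using alg_homD(1)[OF gM(1)] by blast
  then obtain \<iota> where \<iota>: "\<iota> \<in> alg_hom (rees ?M) (rees F)"
      "\<And>y. y \<in> carrier (rees ?M) \<Longrightarrow> gF (\<iota> y) = gM y"
    using alg_hom_lift_inj[OF gM(1) gF(1,2) _ trunc.ralgebra_rees whole.ralgebra_rees] by blast
  have eqI: "x = y" if "x \<in> carrier (rees F)" "y \<in> carrier (rees F)" "gF x = gF y" for x y
    using that gF(2) by (simp add: inj_on_def)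
  have 1: "\<iota> (rees_in ?M x) = rees_in F x" if x: "x \<in> carrier ?M" for x
  proof -
    obtain v where v: "v \<in> order_ge_vec s \<sigma>" "x = \<Psi> v" using x by (rule trunc.\<Psi>_cases)
    then have "v \<in> carrier_vec s" by (simp add: order_ge_vec_def)
    then show ?thesis
      using x v closed trunc.rees_in_closed[of x] whole.rees_in_closed[of x]
      by (intro eqI) (simp_all add: \<iota>(2) gM(4) gF(4) alg_homD(1)[OF \<iota>(1)])
  qed
  have 2: "inj_on \<iota> (carrier (rees ?M))"
    using \<iota>(2) by (intro inj_onI inj_onD[OF gM(2)]) metis+
  have 3: "\<theta> (Var i) = rees_in F (\<Psi> (unit_vec s i))" if i: "i < s" for i
  proof (rule eqI)
    have "linear_form s (unit_vec s i) = (Var i :: (nat, 'k polyR) mpol)"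
      using linear_form_smult_unit_vec[OF i, of "1 :: 'k polyR"] by simp
    then show "gF (\<theta> (Var i)) = gF (rees_in F (\<Psi> (unit_vec s i)))"
      using i by (simp add: \<theta>(2) gF(4))
  qed (use i in \<open>simp_all add: alg_homD(1)[OF \<theta>_hom] whole.rees_in_closed closed\<close>)
  have 4: "\<iota> ` carrier (rees ?M) = \<theta> ` subalg_gen {..<s} (scroll_param \<sigma> ` scroll_vars s \<sigma>)"
  proof -
    have "\<iota> y = \<theta> (gM y)" if "y \<in> carrier (rees ?M)" for y
      using that alg_homD(1)[OF gM(1) that] alg_homD(1)[OF \<iota>(1) that]
      by (intro eqI alg_homD(1)[OF \<theta>_hom]) (simp_all add: \<theta>(2) \<iota>(2))
    then have "\<iota> ` carrier (rees ?M) = \<theta> ` gM ` carrier (rees ?M)"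
      unfolding image_image by (rule image_cong[OF refl])
    then show ?thesis unfolding gM(3) subalg_gen_linear_forms .
  qed
  show ?thesis
    by (rule exI[of _ \<iota>], rule exI[of _ \<theta>], intro conjI ballI allI impI)
      (rule \<iota>(1), erule 1, rule 2, rule \<theta>(1), erule 3, rule 4)
qed

text \<open>Both algebras embed into \<open>R[w]\<close> with the same image.\<close>

theorem rees_trunc_iso_Scr: "\<exists>h. h \<in> alg_iso (rees (trunc_nonneg F gr)) (Scr s \<sigma>)"
proof -
  interpret scroll s \<sigma> "TYPE('k)" .
  let ?M = "trunc_nonneg F gr"
  obtain gM where gM: "gM \<in> alg_hom (rees ?M) (mpol_alg {..<s})" "inj_on gM (carrier (rees ?M))"
    "gM ` carrier (rees ?M) = subalg_gen {..<s} (linear_form s ` order_ge_vec s \<sigma>)"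
    "\<And>v. v \<in> order_ge_vec s \<sigma> \<Longrightarrow> gM (rees_in ?M (\<Psi> v)) = linear_form s v"
    using trunc.rees_embedding by blast
  obtain gS :: "(nat \<times> nat, 'k polyR) mpol set \<Rightarrow> (nat, 'k polyR) mpol"
    where gS: "gS \<in> alg_hom (Scr s \<sigma>) (mpol_alg {..<s})" "inj_on gS (carrier (Scr s \<sigma>))"
    "gS ` carrier (Scr s \<sigma>) = subalg_gen {..<s} (scroll_param \<sigma> ` scroll_vars s \<sigma>)"
    by (rule Scr_embedding)
  have "gM ` carrier (rees ?M) = gS ` carrier (Scr s \<sigma>)"
    unfolding gM(3) gS(3) by (rule subalg_gen_linear_forms)
  then show ?thesis
    by (rule alg_iso_lift_inj[OF gM(1,2) gS(1,2) _ trunc.ralgebra_rees ralgebra_Scr]) (rule exI)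
qed

end

theorem proposition2p5:
  fixes I :: "'k::field polyR set"
    and f :: "'k polyR vec"
    and \<phi> :: "'k polyR mat"
    and n d m s :: nat
    and e \<sigma> :: "nat \<Rightarrow> nat"
  assumes f: "f \<in> carrier_vec n" "\<forall>i<n. f $ i \<in> forms (int d)"
    and I: "I = Idl\<^bsub>ring_of_type_algebra\<^esub> {f $ i | i. i < n}"
    and min_gen: "\<forall>i<n. f $ i \<notin> Idl\<^bsub>ring_of_type_algebra\<^esub> {f $ j | j. j < n \<and> j \<noteq> i}"
    and height: "ideal_height ring_of_type_algebra I = 2"
    and \<phi>: "\<phi> \<in> carrier_mat n (n - 1)" "\<forall>i<n. \<forall>j<n - 1. \<phi> $$ (i, j) \<in> forms (int (e j))"
    and e: "\<forall>j<n - 1. 1 \<le> e j" "\<forall>i j. i \<le> j \<and> j < n - 1 \<longrightarrow> e i \<le> e j"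
    and exact_left: "inj_on (\<lambda>u. \<phi> *\<^sub>v u) (carrier_vec (n - 1))"
    and exact_mid: "(\<lambda>u. \<phi> *\<^sub>v u) ` carrier_vec (n - 1) = {v \<in> carrier_vec n. f \<bullet> v = 0}"
    and m: "1 \<le> m" "m \<le> n - 1"
    and s: "s = n - m"
    and E: "E = coker (first_cols m \<phi>)" "grE = coker_grading (first_cols m \<phi>)"
    and F: "F = dual (dual E)" "grF = dual_grading (dual E) (dual_grading E grE)"
    and \<sigma>: "\<forall>i j. i \<le> j \<and> j < s \<longrightarrow> \<sigma> j \<le> \<sigma> i"
    and \<Psi>: "\<Psi> \<in> graded_iso (module_vec TYPE('k polyR) s) (free_grading s (\<lambda>i. int (\<sigma> i))) F grF"
    and M: "M = trunc_nonneg F grF"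
  shows "(\<exists>\<iota> \<theta>.
            \<iota> \<in> alg_hom (rees M) (rees F) \<and> (\<forall>x\<in>carrier M. \<iota> (rees_in M x) = rees_in F x) \<and>
            inj_on \<iota> (carrier (rees M)) \<and>
            \<theta> \<in> alg_iso (mpol_alg {..<s}) (rees F) \<and>
            (\<forall>i<s. \<theta> (Var i) = rees_in F (\<Psi> (unit_vec s i))) \<and>
            \<iota> ` carrier (rees M) =
              \<theta> ` subalg_gen {..<s} {Const (x0 ^ (\<sigma> i - j) * x1 ^ j) * Var i | i j. i < s \<and> j \<le> \<sigma> i}) \<and>
         (\<exists>h. h \<in> alg_iso (rees M) (Scr s \<sigma>))"
proof -
  have "\<Psi> (0\<^sub>v s) = \<zero>\<^bsub>F\<^esub>"
  proof -
    let ?z = "\<Psi> (0\<^sub>v s)"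
    have z: "?z \<in> carrier F" "?z \<oplus>\<^bsub>F\<^esub> ?z = ?z"
    proof -
      have hom: "\<Psi> \<in> hom (add_monoid (module_vec TYPE('k polyR) s)) (add_monoid F)"
        using \<Psi> by (simp add: graded_iso_def iso_def)
      show "?z \<in> carrier F" using hom by (auto simp: hom_def module_vec_simps Pi_iff)
      have "\<Psi> (v + w) = \<Psi> v \<oplus>\<^bsub>F\<^esub> \<Psi> w" if "v \<in> carrier_vec s" "w \<in> carrier_vec s" for v w
        using hom that by (simp add: hom_def module_vec_simps)
      from this[of "0\<^sub>v s" "0\<^sub>v s"] show "?z \<oplus>\<^bsub>F\<^esub> ?z = ?z" by simp
    qed
    \<comment> \<open>\<open>F\<close> consists of functions, so an idempotent of its addition vanishes at every argument.\<close>
    have ext: "?z \<in> extensional (carrier (dual E))" using z(1) by (simp add: F dual_def[of "dual E"])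
    have "?z x = 0" if "x \<in> carrier (dual E)" for x
    proof -
      have "(?z \<oplus>\<^bsub>F\<^esub> ?z) x = ?z x + ?z x" using that by (simp add: F dual_def[of "dual E"])
      then have "?z x = ?z x + ?z x" unfolding z(2) .
      then show ?thesis by (metis add_cancel_right_right)
    qed
    then have "?z = (\<lambda>x\<in>carrier (dual E). 0)"
      using ext by (intro extensionalityI[of _ "carrier (dual E)"]) auto
    then show ?thesis by (simp add: F dual_def[of "dual E"])
  qed
  then interpret graded_free_module F grF s \<sigma> \<Psi> using \<Psi> by unfold_locales
  have gens: "{Const (x0 ^ (\<sigma> i - j) * x1 ^ j) * Var i | i j. i < s \<and> j \<le> \<sigma> i} =
      (scroll_param \<sigma> ` scroll_vars s \<sigma> :: (nat, 'k polyR) mpol set)"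
    by (auto simp: scroll_param_def scroll_vars_def image_iff)
  show ?thesis
    unfolding M gens using rees_trunc_in_rees rees_trunc_iso_Scr by blast
qed

end
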